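(* For every sequence $\bm\alpha=(\alpha_i)_{i<\omega}$ of ordinals, $v(\bm\alpha)=\#^{S}_{i<\omega}\alpha_i$, where $v(\bm\alpha)$ is the rank of $\bm\alpha$ in the well-founded strict order $\prec$ on $\omega$-indexed sequences of ordinals.
   Context: Notation. $+$ is the usual ordinal sum, $\#$ (binary or finitary) is the Hessenberg natural sum of ordinals, and $\otimes$ is the natural product of ordinals: $\omega^{\xi}\otimes\omega^{\rho}=\omega^{\xi\#\rho}$, extended to arbitrary ordinals in normal form by distributivity over $\#$, with $\alpha\otimes 0=0\otimes\alpha=0$. The ordinal $0$ is neither limit nor successor. Every nonzero ordinal $\zeta$ is uniquely written in (additive) normal form $\zeta=\omega^{\xi_s}+\dots+\omega^{\xi_1}+\omega^{\xi_0}$ with $\xi_s\ge\dots\ge\xi_0$; put $\hat\zeta=\omega^{\xi_s}+\dots+\omega^{\xi_1}$ (last summand removed; $\hat\zeta=0$ if there is only one summand). For a sequence $\bm\alpha=(\alpha_i)_{i<\omega}$ of ordinals, let $\varepsilon_{\bm\alpha}$ be the least ordinal $\varepsilon$ such that $\{i<\omega:\varepsilon\le\alpha_i\}$ is finite, and let $\zeta_{\bm\alpha}$ be the least ordinal $\zeta$ such that $\{i<\omega:\zeta<\alpha_i\}$ is finite. The element $\alpha_i$ (for the index $i$) is e-special if $\alpha_i\ge\varepsilon_{\bm\alpha}$. One always has $\zeta_{\bm\alpha}\le\varepsilon_{\bm\alpha}$. Definition of $\#^{S}$. Let $i_1,\dots,i_h$ enumerate the finite (possibly empty) set of indices of e-special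 elements of $\bm\alpha$. Let $\alpha_{i_p}^{\heartsuit}$ be the unique ordinal with $\zeta_{\bm\alpha}+\alpha_{i_p}^{\heartsuit}=\alpha_{i_p}$ and, if $\zeta_{\bm\alpha}>0$, let $\alpha_{i_p}^{\diamondsuit}$ be the unique ordinal with $\hat\zeta_{\bm\alpha}+\alpha_{i_p}^{\diamondsuit}=\alpha_{i_p}$. If $\zeta_{\bm\alpha}>0$, let $\omega^{\xi_0}$ be the last summand in the normal form of $\zeta_{\bm\alpha}$. (S1) If $\zeta_{\bm\alpha}>0$, $\xi_0$ is a limit ordinal, and only finitely many elements of $\bm\alpha$ are $\ge\zeta_{\bm\alpha}$ (i.e. $\zeta_{\bm\alpha}=\varepsilon_{\bm\alpha}$), then $\#^{S}_{i<\omega}\alpha_i=(\hat\zeta_{\bm\alpha}\otimes\omega)\,\#\,\omega^{\xi_0}\,\#\,\alpha_{i_1}^{\diamondsuit}\,\#\cdots\#\,\alpha_{i_h}^{\diamondsuit}$. (S2) Otherwise (including the case $\zeta_{\bm\alpha}=0$), $\#^{S}_{i<\omega}\alpha_i=(\zeta_{\bm\alpha}\otimes\omega)\,\#\,\alpha_{i_1}^{\heartsuit}\,\#\cdots\#\,\alpha_{i_h}^{\heartsuit}$. The order $\prec$. For $\omega$-indexed sequences of ordinals, $\bm\beta\prec\bm\alpha$ means that there are some $\bar\imath<\omega$, some finite set $F\subseteq\omega$ and some ordinal $\beta$ such that $\beta_{\bar\imath}\le\beta<\alpha_{\bar\imath}$; $\beta_i\le\alpha_i$ for every $i\in\omega$;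 and $\beta_i\le\beta$ for every $i\notin F$. The relation $\prec$ is a well-founded strict order, and the rank $v(\bm\alpha)$ is the smallest ordinal strictly larger than $v(\bm\beta)$ for every $\bm\beta\prec\bm\alpha$. *)

theory Defs
  imports "HOL-Library.Infinite_Set" "HOL-Library.Infinite_Typeclass"
begin

section \<open>Ordinals\<close>

text \<open>
  HOL has no type of all ordinals. An element of \<open>'a ordinal\<close> is the order type of a well-order
  whose field consists of elements of \<open>'a\<close>. For infinite \<open>'a\<close> these are exactly the ordinals
  below the cardinal successor of the cardinality of \<open>'a\<close>. They are closed under suprema of
  families indexed by a set of size at most that of \<open>'a\<close> (lemma \<open>ordinal_bounded\<close>), in
  particular of countable families and of families indexed by the predecessors of an ordinal, so
  every \<open>LEAST\<close> in the arithmetic below selects from a nonempty set. The type \<open>'a\<close> is arbitrary,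
  hence so are the ordinals.
\<close>

quotient_type 'a ordinal = "'a rel" / partial: "\<lambda>r s. (r, s) \<in> ordIso"
proof (rule part_equivpI)
  show "\<exists>r::'a rel. (r, r) \<in> ordIso"
    by (rule exI[of _ "{}"]) (rule ordIso_reflexive, simp)
  show "symp (\<lambda>r s::'a rel. (r, s) \<in> ordIso)"
    by (auto intro: sympI ordIso_symmetric)
  show "transp (\<lambda>r s::'a rel. (r, s) \<in> ordIso)"
    by (auto intro: transpI ordIso_transitive)
qed

instantiation ordinal :: (type) wellorder
begin

lift_definition less_eq_ordinal :: "'a ordinal \<Rightarrow> 'a ordinal \<Rightarrow> bool"
  is "\<lambda>r s. (r, s) \<in> ordLeq"
  by (meson ordIso_ordLeq_trans ordIso_symmetric ordLeq_ordIso_trans)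

lift_definition less_ordinal :: "'a ordinal \<Rightarrow> 'a ordinal \<Rightarrow> bool"
  is "\<lambda>r s. (r, s) \<in> ordLess"
  by (meson ordIso_ordLess_trans ordIso_symmetric ordLess_ordIso_trans)

lemma rep_ordinal_refl: "(rep_ordinal x, rep_ordinal x) \<in> ordIso"
  by (rule Quotient_rep_reflp[OF Quotient_ordinal])

lemma rep_ordinal_Well_order: "Well_order (rep_ordinal x)"
  using rep_ordinal_refl[of x] unfolding ordIso_def by auto

lemma ordinal_le_iff: "x \<le> y \<longleftrightarrow> (rep_ordinal x, rep_ordinal y) \<in> ordLeq"
  by (simp add: less_eq_ordinal_def)

lemma ordinal_less_iff: "x < y \<longleftrightarrow> (rep_ordinal x, rep_ordinal y) \<in> ordLess"
  by (simp add: less_ordinal_def)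

lemma ordinal_eq_iff: "x = y \<longleftrightarrow> (rep_ordinal x, rep_ordinal y) \<in> ordIso"
  using Quotient_rel_rep[OF Quotient_ordinal] by blast

lemma rep_abs_ordinal: "Well_order r \<Longrightarrow> (rep_ordinal (abs_ordinal r), r) \<in> ordIso"
  by (rule Quotient_rep_abs[OF Quotient_ordinal]) (rule ordIso_reflexive)

instance
proof
  fix x y z :: "'a ordinal"
  show "x < y \<longleftrightarrow> x \<le> y \<and> \<not> y \<le> x"
    using not_ordLeq_iff_ordLess[OF rep_ordinal_Well_order rep_ordinal_Well_order, of y x]
    by (auto simp: ordinal_le_iff ordinal_less_iff intro: ordLess_imp_ordLeq)
  show "x \<le> x"
    by (simp add: ordinal_le_iff ordLeq_reflexive rep_ordinal_Well_order)
  show "x \<le> y \<Longrightarrow> y \<le> z \<Longrightarrow> x \<le> z"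
    unfolding ordinal_le_iff by (rule ordLeq_transitive)
  show "x \<le> y \<Longrightarrow> y \<le> x \<Longrightarrow> x = y"
    by (simp add: ordinal_le_iff ordinal_eq_iff ordIso_iff_ordLeq)
  show "x \<le> y \<or> y \<le> x"
    using ordLeq_total[OF rep_ordinal_Well_order rep_ordinal_Well_order]
    by (simp add: ordinal_le_iff)
next
  fix P :: "'a ordinal \<Rightarrow> bool" and x :: "'a ordinal"
  assume step: "\<And>x. (\<And>y. y < x \<Longrightarrow> P y) \<Longrightarrow> P x"
  have "wf (inv_image ordLess (rep_ordinal :: 'a ordinal \<Rightarrow> _))"
    by (rule wf_inv_image[OF wf_ordLess])
  then show "P x"
    by (induction x rule: wf_induct_rule) (auto intro: step simp: ordinal_less_iff inv_image_def)
qed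

end

lemma ordinal_initial_segment_ordLeq:
  "(card_of {y. y < (x::'a ordinal)}, card_of (UNIV :: 'a set)) \<in> ordLeq"
proof -
  have "\<exists>a. (rep_ordinal y, Restr (rep_ordinal x) (underS (rep_ordinal x) a)) \<in> ordIso"
    if "y < x" for y
    using that ordLess_iff_ordIso_Restr[OF rep_ordinal_Well_order rep_ordinal_Well_order, of y x]
    by (auto simp: ordinal_less_iff)
  then obtain f where
    f: "\<And>y. y < x \<Longrightarrow> (rep_ordinal y, Restr (rep_ordinal x) (underS (rep_ordinal x) (f y))) \<in> ordIso"
    by metis
  have "inj_on f {y. y < x}"
    by (rule inj_onI)
      (metis f mem_Collect_eq ordIso_symmetric ordIso_transitive ordinal_eq_iff)
  then show ?thesis
    using card_of_ordLeq[of "{y. y < x}" "UNIV :: 'a set"] by blast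
qed

lemma ordinal_bounded:
  fixes A :: "'a::infinite ordinal set"
  assumes "(card_of A, card_of (UNIV :: 'a set)) \<in> ordLeq"
  shows "\<exists>b. \<forall>x\<in>A. x < b"
proof (rule ccontr)
  assume "\<nexists>b. \<forall>x\<in>A. x < b"
  then have "\<forall>b. \<exists>x\<in>A. b \<le> x"
    by (auto simp: not_less)
  then have univ: "(UNIV :: 'a ordinal set) = (\<Union>x\<in>A. insert x {y. y < x})"
    by (auto simp: le_less)
  have "(card_of (insert x {y. y < x}), card_of (UNIV :: 'a set)) \<in> ordLeq" for x :: "'a ordinal"
  proof (cases "finite {y. y < x}")
    case True
    then show ?thesis
      by (intro ordLess_imp_ordLeq finite_ordLess_infinite card_of_Well_order)
        (auto simp: Field_card_of infinite_UNIV)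
  next
    case False
    then obtain h where "bij_betw h {y. y < x} (insert x {y. y < x})"
      using infinite_imp_bij_betw2[OF False, of x] by auto
    then have "(card_of (insert x {y. y < x}), card_of {y. y < x}) \<in> ordIso"
      using card_of_ordIsoI ordIso_symmetric by blast
    then show ?thesis
      using ordinal_initial_segment_ordLeq[of x] ordIso_ordLeq_trans by blast
  qed
  then have "(card_of (\<Union>x\<in>A. insert x {y. y < x}), card_of (UNIV :: 'a set)) \<in> ordLeq"
    by (intro card_of_UNION_ordLeq_infinite assms) (auto simp: infinite_UNIV)
  then have "(card_of (UNIV :: 'a ordinal set), card_of (UNIV :: 'a set)) \<in> ordLeq"
    by (simp add: univ[symmetric])
  then obtain f :: "'a ordinal \<Rightarrow> 'a" where f: "inj f"
    unfolding card_of_ordLeq[symmetric] by auto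
  define L where "L = {(x :: 'a ordinal, y). x \<le> y}"
  have FL: "Field L = UNIV"
    by (auto simp: L_def Field_def)
  have "wf (L - Id)"
    by (rule wf_subset[OF wf[where 'a="'a ordinal"]]) (auto simp: L_def)
  then have L: "Well_order L"
    unfolding well_order_on_def linear_order_on_def partial_order_on_def preorder_on_def FL
    by (auto simp: L_def refl_on_def trans_def antisym_def total_on_def)
  have uL: "underS L x = {y. y < x}" for x
    by (auto simp: L_def underS_def)
  have le: "(rep_ordinal x, Restr L (underS L x)) \<in> ordLeq" for x :: "'a ordinal"
  proof (induction x rule: less_induct)
    case (less x)
    have "(Restr (rep_ordinal x) (underS (rep_ordinal x) a), Restr L (underS L x)) \<in> ordLess"
      if a: "a \<in> Field (rep_ordinal x)" for a
    proof -
      let ?r = "Restr (rep_ordinal x) (underS (rep_ordinal x) a)"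
      have iso: "(rep_ordinal (abs_ordinal ?r), ?r) \<in> ordIso"
        by (rule rep_abs_ordinal[OF Well_order_Restr[OF rep_ordinal_Well_order]])
      have "(?r, rep_ordinal x) \<in> ordLess"
        by (rule underS_Restr_ordLess[OF rep_ordinal_Well_order]) (use a in auto)
      then have lt: "abs_ordinal ?r < x"
        using iso ordIso_ordLess_trans by (auto simp: ordinal_less_iff)
      have "wo_rel.ofilter L (underS L y)" for y
        by (rule wo_rel.underS_ofilter) (simp add: wo_rel_def L)
      moreover have "underS L (abs_ordinal ?r) \<subset> underS L x"
        using lt unfolding uL by fastforce
      ultimately have "(Restr L (underS L (abs_ordinal ?r)), Restr L (underS L x)) \<in> ordLess"
        using ofilter_subset_ordLess[OF L] by blast
      then show ?thesis
        using less.IH[OF lt] iso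
        by (meson ordIso_ordLeq_trans ordIso_symmetric ordLeq_ordLess_trans)
    qed
    then show ?case
      using ordLeq_iff_ordLess_Restr[OF rep_ordinal_Well_order Well_order_Restr[OF L]] by blast
  qed
  let ?R = "dir_image L f"
  have R: "Well_order ?R"
    using Well_order_dir_image[OF L, of f] f by (simp add: FL)
  have "(L, rep_ordinal (abs_ordinal ?R)) \<in> ordIso"
    using dir_image_ordIso[OF L, of f] f rep_abs_ordinal[OF R]
    by (metis FL ordIso_symmetric ordIso_transitive)
  moreover have "(Restr L (underS L (abs_ordinal ?R)), L) \<in> ordLess"
    by (rule underS_Restr_ordLess[OF L]) (simp add: FL)
  ultimately have "abs_ordinal ?R < abs_ordinal ?R"
    unfolding ordinal_less_iff
    using le[of "abs_ordinal ?R"] by (meson ordLeq_ordLess_trans ordLess_ordIso_trans)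
  then show False by simp
qed


section \<open>Ordinal arithmetic\<close>

instantiation ordinal :: (infinite) "{zero, one, plus, times}"
begin

definition zero_ordinal :: "'a ordinal" where
  "(0 :: 'a ordinal) = (LEAST \<gamma>. True)"

definition one_ordinal :: "'a ordinal" where
  "(1 :: 'a ordinal) = (LEAST \<gamma>. 0 < \<gamma>)"

text \<open>
  The usual sum and product, each by transfinite recursion on the second argument. The single
  clause subsumes the zero, successor and limit clauses.
\<close>

function plus_ordinal :: "'a ordinal \<Rightarrow> 'a ordinal \<Rightarrow> 'a ordinal" where
  "plus_ordinal \<alpha> \<beta> =
     (LEAST \<gamma>. \<alpha> \<le> \<gamma> \<and> (\<forall>\<delta>. \<delta> < \<beta> \<longrightarrow> plus_ordinal \<alpha> \<delta> < \<gamma>))"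
  by auto
termination by (relation "inv_image {(x, y). x < y} snd") (rule wf_inv_image[OF wf], simp)

declare plus_ordinal.simps [simp del]

function times_ordinal :: "'a ordinal \<Rightarrow> 'a ordinal \<Rightarrow> 'a ordinal" where
  "times_ordinal \<alpha> \<beta> =
     (LEAST \<gamma>. \<forall>\<delta>. \<delta> < \<beta> \<longrightarrow> times_ordinal \<alpha> \<delta> + \<alpha> \<le> \<gamma>)"
  by auto
termination by (relation "inv_image {(x, y). x < y} snd") (rule wf_inv_image[OF wf], simp)

instance ..

end

declare times_ordinal.simps [simp del]

definition is_limit :: "'a::infinite ordinal \<Rightarrow> bool" where
  "is_limit \<alpha> \<longleftrightarrow> \<alpha> \<noteq> 0 \<and> (\<nexists>\<delta>. \<alpha> = \<delta> + 1)"

definition omega :: "'a::infinite ordinal"  (\<open>\<omega>\<close>) where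
  "\<omega> = (LEAST \<gamma>. is_limit \<gamma>)"

text \<open>The power \<open>\<omega>\<^sup>\<xi>\<close>, again with one clause for zero, successor and limit exponents.\<close>

function omega_pow :: "'a::infinite ordinal \<Rightarrow> 'a ordinal" where
  "omega_pow \<xi> = (LEAST \<gamma>. 1 \<le> \<gamma> \<and> (\<forall>\<delta>. \<delta> < \<xi> \<longrightarrow> omega_pow \<delta> * \<omega> \<le> \<gamma>))"
  by auto
termination by (relation "{(x, y). x < y}") (rule wf, simp)

declare omega_pow.simps [simp del]

text \<open>
  Additive normal form, given by the list of exponents \<open>[\<xi>\<^sub>s, \<dots>, \<xi>\<^sub>1, \<xi>\<^sub>0]\<close> with
  \<open>\<xi>\<^sub>s \<ge> \<dots> \<ge> \<xi>\<^sub>1 \<ge> \<xi>\<^sub>0\<close>. The list of \<open>0\<close> is empty.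
\<close>

definition sum_omega_pows :: "'a::infinite ordinal list \<Rightarrow> 'a ordinal" where
  "sum_omega_pows \<xi>s = foldr (\<lambda>\<xi> \<alpha>. omega_pow \<xi> + \<alpha>) \<xi>s 0"

definition nf_exponents :: "'a::infinite ordinal \<Rightarrow> 'a ordinal list" where
  "nf_exponents \<zeta> = (THE \<xi>s. sorted_wrt (\<ge>) \<xi>s \<and> sum_omega_pows \<xi>s = \<zeta>)"

definition nat_sum :: "'a::infinite ordinal \<Rightarrow> 'a ordinal \<Rightarrow> 'a ordinal"  (infixl \<open>\<oplus>\<close> 65) where
  "\<alpha> \<oplus> \<beta> = sum_omega_pows (rev (sort (nf_exponents \<alpha> @ nf_exponents \<beta>)))"

definition nat_sum_list :: "'a::infinite ordinal list \<Rightarrow> 'a ordinal" where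
  "nat_sum_list \<alpha>s = foldr (\<oplus>) \<alpha>s 0"

definition nat_prod :: "'a::infinite ordinal \<Rightarrow> 'a ordinal \<Rightarrow> 'a ordinal"  (infixl \<open>\<otimes>\<close> 70) where
  "\<alpha> \<otimes> \<beta> =
     nat_sum_list [omega_pow (\<xi> \<oplus> \<rho>). \<xi> \<leftarrow> nf_exponents \<alpha>, \<rho> \<leftarrow> nf_exponents \<beta>]"

text \<open>The normal form with its last summand removed.\<close>

definition nf_init :: "'a::infinite ordinal \<Rightarrow> 'a ordinal" where
  "nf_init \<zeta> = sum_omega_pows (butlast (nf_exponents \<zeta>))"

text \<open>The unique \<open>\<delta>\<close> with \<open>\<beta> + \<delta> = \<alpha>\<close>; meaningful for \<open>\<beta> \<le> \<alpha>\<close>.\<close>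

definition ord_diff :: "'a::infinite ordinal \<Rightarrow> 'a ordinal \<Rightarrow> 'a ordinal" where
  "ord_diff \<alpha> \<beta> = (THE \<delta>. \<beta> + \<delta> = \<alpha>)"


section \<open>The infinite natural sum\<close>

definition eps :: "(nat \<Rightarrow> 'a::infinite ordinal) \<Rightarrow> 'a ordinal" where
  "eps \<alpha> = (LEAST \<epsilon>. finite {i. \<epsilon> \<le> \<alpha> i})"

definition zeta :: "(nat \<Rightarrow> 'a::infinite ordinal) \<Rightarrow> 'a ordinal" where
  "zeta \<alpha> = (LEAST \<zeta>. finite {i. \<zeta> < \<alpha> i})"

definition e_special :: "(nat \<Rightarrow> 'a::infinite ordinal) \<Rightarrow> nat set" where
  "e_special \<alpha> = {i. eps \<alpha> \<le> \<alpha> i}"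

text \<open>
  The set of e-special indices is always finite. The ordinals \<open>ord_diff (\<alpha> i) (nf_init \<zeta>)\<close> and
  \<open>ord_diff (\<alpha> i) \<zeta>\<close> are written
  \<open>\<alpha> i\<close> with superscript \<open>\<diamondsuit>\<close> and \<open>\<heartsuit>\<close>, respectively.
\<close>

definition nat_sum_S :: "(nat \<Rightarrow> 'a::infinite ordinal) \<Rightarrow> 'a ordinal" where
  "nat_sum_S \<alpha> =
     (let \<zeta> = zeta \<alpha>; \<xi>\<^sub>0 = last (nf_exponents \<zeta>); js = sorted_list_of_set (e_special \<alpha>) in
      if \<zeta> > 0 \<and> is_limit \<xi>\<^sub>0 \<and> finite {i. \<zeta> \<le> \<alpha> i}
      then (nf_init \<zeta> \<otimes> \<omega>) \<oplus> omega_pow \<xi>\<^sub>0 \<oplus>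
             nat_sum_list (map (\<lambda>i. ord_diff (\<alpha> i) (nf_init \<zeta>)) js)
      else (\<zeta> \<otimes> \<omega>) \<oplus> nat_sum_list (map (\<lambda>i. ord_diff (\<alpha> i) \<zeta>) js))"


section \<open>The order on sequences and its rank\<close>

definition seq_less :: "(nat \<Rightarrow> 'a::infinite ordinal) \<Rightarrow> (nat \<Rightarrow> 'a ordinal) \<Rightarrow> bool"
  (infix \<open>\<prec>\<close> 50) where
  "\<beta> \<prec> \<alpha> \<longleftrightarrow>
     (\<exists>j F b. finite F \<and> \<beta> j \<le> b \<and> b < \<alpha> j \<and> (\<forall>i. \<beta> i \<le> \<alpha> i) \<and> (\<forall>i. i \<notin> F \<longrightarrow> \<beta> i \<le> b))"

lemma seq_less_irrefl: "\<not> \<alpha> \<prec> \<alpha>"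
  by (auto simp: seq_less_def)

lemma seq_less_trans: "\<gamma> \<prec> \<beta> \<Longrightarrow> \<beta> \<prec> \<alpha> \<Longrightarrow> \<gamma> \<prec> \<alpha>"
  unfolding seq_less_def by (meson order_trans)

lemma wf_seq_less: "wf {(\<beta>, \<alpha>). \<beta> \<prec> (\<alpha> :: nat \<Rightarrow> 'a::infinite ordinal)}"
proof -
  have False if desc: "\<And>n. s (Suc n) \<prec> s n" for s :: "nat \<Rightarrow> nat \<Rightarrow> 'a ordinal"
  proof -
    obtain j F b where
      fin: "\<And>n. finite (F n)" and
      j: "\<And>n. s (Suc n) (j n) \<le> b n" "\<And>n. b n < s n (j n)" and
      mono: "\<And>n i. s (Suc n) i \<le> s n i" and
      F: "\<And>n i. i \<notin> F n \<Longrightarrow> s (Suc n) i \<le> b n"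
      using desc unfolding seq_less_def by metis
    have anti: "s n i \<le> s m i" if "m \<le> n" for m n i
      using that mono lift_Suc_antimono_le[of "\<lambda>n. s n i"] by blast
    have "(LEAST x. x \<in> range b) \<in> range b"
      by (rule LeastI[of _ "b 0"]) simp
    then obtain m where "b m = (LEAST x. x \<in> range b)"
      by force
    then have m: "b m \<le> b n" for n
      by (simp add: Least_le)
    have "j n \<in> F m" if "n \<in> {Suc m..}" for n
    proof (rule ccontr)
      assume "j n \<notin> F m"
      then have "s (Suc m) (j n) \<le> b m" by (rule F)
      moreover have "s n (j n) \<le> s (Suc m) (j n)" using anti that by simp
      ultimately show False using m[of n] j(2)[of n] by simp
    qed
    then have "finite (j ` {Suc m..})"
      using finite_subset[OF _ fin[of m]] by blast
    then obtain k where k: "infinite {n \<in> {Suc m..}. j n = j k}"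
      using pigeonhole_infinite[of "{Suc m..}" j] infinite_Ici[of "Suc m"] by blast
    define i where "i = j k"
    have "(LEAST x. x \<in> range (\<lambda>n. s n i)) \<in> range (\<lambda>n. s n i)"
      by (rule LeastI[of _ "s 0 i"]) simp
    then obtain l where "s l i = (LEAST x. x \<in> range (\<lambda>n. s n i))"
      by force
    then have l: "s l i \<le> s n i" for n
      by (simp add: Least_le)
    obtain n where n: "n \<ge> l" "j n = i"
      using k unfolding infinite_nat_iff_unbounded_le i_def by blast
    have "s (Suc n) i < s n i"
      using j[of n] n(2) by auto
    then show False
      using anti[OF n(1), of i] l[of "Suc n"] by simp
  qed
  then show ?thesis by (auto simp: wf_iff_no_infinite_down_chain)
qed

function seq_rank :: "(nat \<Rightarrow> 'a::infinite ordinal) \<Rightarrow> 'a ordinal" where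
  "seq_rank \<alpha> = (LEAST \<gamma>. \<forall>\<beta>. \<beta> \<prec> \<alpha> \<longrightarrow> seq_rank \<beta> < \<gamma>)"
  by auto
termination by (relation "{(\<beta>, \<alpha>). \<beta> \<prec> \<alpha>}") (rule wf_seq_less, simp)

declare seq_rank.simps [simp del]

end

theory Submission
  imports Defs "HOL-Library.Multiset_Order"
begin

text \<open>
  The rank is the unique function \<open>v\<close> such that \<open>v \<alpha>\<close> is the least strict upper bound of \<open>v \<beta>\<close> for
  \<open>\<beta> \<prec> \<alpha>\<close>. Hence it suffices that the infinite natural sum is strictly monotone
  (\<open>nat_sum_S_strict_mono\<close>) and that the values at \<open>\<beta> \<prec> \<alpha>\<close> are cofinal below the value at \<open>\<alpha>\<close>
  (\<open>nat_sum_S_cofinal\<close>).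

  Both halves are computations with natural sums, and these become transparent when an ordinal is
  replaced by the multiset of the exponents in its normal form: the natural sum is then the sum of
  multisets, the order of the ordinals is the multiset order (\<open>of_exponents_strict_mono\<close>), and \<open>x \<otimes> \<omega>\<close>
  arises by adding \<open>1\<close> to every exponent. Differences are written \<open>x \<ominus> c\<close>, the least \<open>\<delta>\<close> with
  \<open>x \<le> c + \<delta>\<close>. The central quantity is \<open>shifted_sum c \<alpha> I\<close>, the natural sum of \<open>c \<otimes> \<omega>\<close> and the
  differences \<open>\<alpha> i \<ominus> c\<close> for \<open>i\<close> in a finite set \<open>I\<close>. Its base may be varied:
  raising \<open>c\<close> to \<open>d\<close> yields a larger exponent in \<open>d \<otimes> \<omega>\<close> than occurs in \<open>d \<ominus> c\<close>, which outweighs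
  finitely many copies of \<open>d \<ominus> c\<close> lost in the differences (\<open>shifted_sum_base_strict_mono\<close>).

  For monotonicity, let \<open>\<beta> \<prec> \<alpha>\<close>. If \<open>\<zeta>\<close> is the same for both sequences, then \<open>\<beta>\<close> is strictly smaller
  at some index that contributes to the sum of \<open>\<alpha>\<close>. If \<open>\<zeta>\<close> is smaller for \<open>\<beta>\<close>, then the base used for
  \<open>\<beta>\<close> is raised to that of \<open>\<alpha>\<close>. When the first clause applies to \<open>\<alpha>\<close>, the last exponent \<open>\<xi>\<close> of its \<open>\<zeta>\<close>
  is a limit, and the base for \<open>\<beta>\<close> becomes some \<open>nf_init \<zeta> + \<eta>\<close> with \<open>\<eta> < omega_pow \<xi>\<close>; then
  \<open>\<eta> \<otimes> \<omega>\<close> and the finitely many differences outside of the sum of \<open>\<alpha>\<close> remain below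
  \<open>omega_pow \<xi>\<close>, which is the additional summand of that clause.

  For cofinality, a multiset below that of \<open>\<alpha>\<close> is bounded by one in which a single exponent \<open>m\<close> is
  traded for finitely many smaller ones (\<open>multiset_less_exchangeE\<close>). If \<open>m\<close> belongs to the summand of
  some \<open>\<alpha> j\<close>, then \<open>\<alpha> j\<close> is decreased accordingly. If \<open>m\<close> belongs to the remaining part, then all but
  finitely many entries are cut down to some \<open>b < \<zeta>\<close>, which turns \<open>b\<close> into the new base
  (\<open>ex_truncation\<close>); \<open>b\<close> is \<open>nf_init \<zeta>\<close>, possibly with multiples of a smaller power of \<open>\<omega>\<close> added. When
  infinitely many entries equal \<open>\<zeta>\<close>, any finite number of them may be kept in addition.
\<close>


section \<open>Ordinal arithmetic\<close>

lemma ex_bound_segment: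
  fixes f :: "'a::infinite ordinal \<Rightarrow> 'a ordinal"
  shows "\<exists>b. \<forall>\<delta><\<beta>. f \<delta> < b"
proof -
  have "(card_of (f ` {\<delta>. \<delta> < \<beta>}), card_of (UNIV :: 'a set)) \<in> ordLeq"
    by (rule ordLeq_transitive[OF card_of_image ordinal_initial_segment_ordLeq])
  from ordinal_bounded[OF this] show ?thesis by auto
qed

lemma ex_bound_sequence:
  fixes f :: "nat \<Rightarrow> 'a::infinite ordinal"
  shows "\<exists>b. \<forall>n. f n < b"
proof -
  have "(card_of (UNIV :: nat set), card_of (UNIV :: 'a set)) \<in> ordLeq"
    using infinite_iff_card_of_nat infinite_UNIV by blast
  then have "(card_of (range f), card_of (UNIV :: 'a set)) \<in> ordLeq"
    by (rule ordLeq_transitive[OF card_of_image])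
  from ordinal_bounded[OF this] show ?thesis by auto
qed

lemma ordinal_zero_le [simp]: "0 \<le> (x :: 'a::infinite ordinal)"
  unfolding zero_ordinal_def by (rule Least_le) simp

lemma ordinal_not_less_zero [simp]: "\<not> x < (0 :: 'a::infinite ordinal)"
  by (simp add: not_less)

lemma ordinal_le_zero_iff [simp]: "x \<le> 0 \<longleftrightarrow> x = (0 :: 'a::infinite ordinal)"
  using ordinal_zero_le order_antisym by blast

lemma ordinal_pos_iff: "0 < x \<longleftrightarrow> x \<noteq> (0 :: 'a::infinite ordinal)"
  using le_less by fastforce

lemma ordinal_less_one_iff [simp]: "x < 1 \<longleftrightarrow> x = (0 :: 'a::infinite ordinal)"
proof -
  obtain b :: "'a ordinal" where "0 < b"
    using ex_bound_sequence[of "\<lambda>_. 0"] by blast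
  then have "0 < (1 :: 'a ordinal)"
    unfolding one_ordinal_def by (rule LeastI)
  moreover have "x = 0" if "x < 1"
    using that not_less_Least ordinal_pos_iff unfolding one_ordinal_def by blast
  ultimately show ?thesis by auto
qed

lemma ordinal_one_le_iff [simp]: "1 \<le> x \<longleftrightarrow> x \<noteq> (0 :: 'a::infinite ordinal)"
  by (metis not_less ordinal_less_one_iff)

instance ordinal :: (infinite) zero_neq_one
  by standard (metis ordinal_less_one_iff less_irrefl)


subsection \<open>Addition\<close>

text \<open>
  The recursion selects a least element, which exists because an initial segment is small. Once this
  is known, the three facts below replace the recursion.
\<close>

lemma
  fixes \<alpha> \<beta> :: "'a::infinite ordinal"
  shows ordinal_add_ge_left [simp]: "\<alpha> \<le> \<alpha> + \<beta>"
    and ordinal_add_strict_mono_right: "\<delta> < \<beta> \<Longrightarrow> \<alpha> + \<delta> < \<alpha> + \<beta>"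
    and ordinal_add_least: "\<alpha> \<le> \<gamma> \<Longrightarrow> (\<And>\<delta>. \<delta> < \<beta> \<Longrightarrow> \<alpha> + \<delta> < \<gamma>) \<Longrightarrow> \<alpha> + \<beta> \<le> \<gamma>"
proof -
  obtain b where b: "\<forall>\<delta><\<beta>. \<alpha> + \<delta> < b"
    using ex_bound_segment[of \<beta> "\<lambda>\<delta>. \<alpha> + \<delta>"] by blast
  have "\<alpha> \<le> \<alpha> + \<beta> \<and> (\<forall>\<delta>. \<delta> < \<beta> \<longrightarrow> \<alpha> + \<delta> < \<alpha> + \<beta>)"
    unfolding plus_ordinal.simps[of \<alpha> \<beta>]
    by (rule LeastI[of "\<lambda>\<gamma>. \<alpha> \<le> \<gamma> \<and> (\<forall>\<delta>. \<delta> < \<beta> \<longrightarrow> \<alpha> + \<delta> < \<gamma>)" "max \<alpha> b"])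
      (use b in \<open>auto simp: less_max_iff_disj\<close>)
  then show "\<alpha> \<le> \<alpha> + \<beta>" "\<delta> < \<beta> \<Longrightarrow> \<alpha> + \<delta> < \<alpha> + \<beta>"
    by auto
  show "\<alpha> + \<beta> \<le> \<gamma>" if "\<alpha> \<le> \<gamma>" "\<And>\<delta>. \<delta> < \<beta> \<Longrightarrow> \<alpha> + \<delta> < \<gamma>"
    unfolding plus_ordinal.simps[of \<alpha> \<beta>] by (rule Least_le) (use that in auto)
qed

lemma ordinal_add_less_cancel [simp]: "\<alpha> + \<beta> < \<alpha> + \<gamma> \<longleftrightarrow> \<beta> < (\<gamma> :: 'a::infinite ordinal)"
  by (metis ordinal_add_strict_mono_right linorder_neqE order_less_asym)

lemma ordinal_add_le_cancel [simp]: "\<alpha> + \<beta> \<le> \<alpha> + \<gamma> \<longleftrightarrow> \<beta> \<le> (\<gamma> :: 'a::infinite ordinal)"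
  by (meson not_less ordinal_add_less_cancel)

lemma ordinal_add_ge_right [simp]: "\<beta> \<le> \<alpha> + (\<beta> :: 'a::infinite ordinal)"
proof (induction \<beta> rule: less_induct)
  case (less \<beta>)
  show ?case
  proof (rule ccontr)
    assume "\<not> \<beta> \<le> \<alpha> + \<beta>"
    then have *: "\<alpha> + \<beta> < \<beta>" by simp
    from less[OF this] show False
      using ordinal_add_strict_mono_right[OF *, of \<alpha>] by simp
  qed
qed

lemma ordinal_le_imp_ex_add:
  assumes "\<alpha> \<le> (x :: 'a::infinite ordinal)"
  shows "\<exists>\<delta>. x = \<alpha> + \<delta>"
proof -
  define \<delta> where "\<delta> = (LEAST \<delta>. x \<le> \<alpha> + \<delta>)"
  have "x \<le> \<alpha> + \<delta>"
    unfolding \<delta>_def by (rule LeastI[of _ x]) simp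
  moreover have "\<alpha> + d < x" if "d < \<delta>" for d
    using not_less_Least that unfolding \<delta>_def by (meson not_less)
  then have "\<alpha> + \<delta> \<le> x"
    by (intro ordinal_add_least assms)
  ultimately show ?thesis using order_antisym by blast
qed

lemma ordinal_add_assoc: "(\<alpha> + \<beta>) + \<gamma> = \<alpha> + (\<beta> + (\<gamma> :: 'a::infinite ordinal))"
proof (induction \<gamma> rule: less_induct)
  case (less \<gamma>)
  show ?case
  proof (rule order_antisym)
    show "(\<alpha> + \<beta>) + \<gamma> \<le> \<alpha> + (\<beta> + \<gamma>)"
      by (rule ordinal_add_least) (simp_all add: less)
    show "\<alpha> + (\<beta> + \<gamma>) \<le> (\<alpha> + \<beta>) + \<gamma>"
    proof (rule ordinal_add_least)
      show "\<alpha> \<le> (\<alpha> + \<beta>) + \<gamma>"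
        using order_trans[OF ordinal_add_ge_left ordinal_add_ge_left] .
      fix \<delta> assume \<delta>: "\<delta> < \<beta> + \<gamma>"
      show "\<alpha> + \<delta> < (\<alpha> + \<beta>) + \<gamma>"
      proof (cases "\<delta> < \<beta>")
        case True
        then have "\<alpha> + \<delta> < \<alpha> + \<beta>" by simp
        then show ?thesis using less_le_trans ordinal_add_ge_left by blast
      next
        case False
        then obtain d where d: "\<delta> = \<beta> + d"
          using ordinal_le_imp_ex_add[of \<beta> \<delta>] by (auto simp: not_less)
        with \<delta> have "d < \<gamma>" by simp
        then show ?thesis using less[of d] d by (metis ordinal_add_less_cancel)
      qed
    qed
  qed
qed

lemma ordinal_add_zero: "\<alpha> + 0 = (\<alpha> :: 'a::infinite ordinal)"
  by (rule order_antisym[OF ordinal_add_least]) simp_all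

lemma ordinal_zero_add: "0 + \<beta> = (\<beta> :: 'a::infinite ordinal)"
proof (induction \<beta> rule: less_induct)
  case (less \<beta>)
  show ?case by (rule order_antisym[OF ordinal_add_least]) (simp_all add: less)
qed

instance ordinal :: (infinite) monoid_add
  by standard (simp_all add: ordinal_add_assoc ordinal_add_zero ordinal_zero_add)

lemma ordinal_add_mono_left:
  assumes "\<alpha> \<le> (\<alpha>' :: 'a::infinite ordinal)"
  shows "\<alpha> + \<beta> \<le> \<alpha>' + \<beta>"
proof (induction \<beta> rule: less_induct)
  case (less \<beta>)
  show ?case
  proof (rule ordinal_add_least)
    show "\<alpha> \<le> \<alpha>' + \<beta>" using assms order_trans ordinal_add_ge_left by blast
    show "\<alpha> + \<delta> < \<alpha>' + \<beta>" if "\<delta> < \<beta>" for \<delta>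
      using less[OF that] that ordinal_add_strict_mono_right le_less_trans by blast
  qed
qed

lemma ordinal_less_add_one_iff [simp]: "x < \<alpha> + 1 \<longleftrightarrow> x \<le> (\<alpha> :: 'a::infinite ordinal)"
proof
  assume x: "x < \<alpha> + 1"
  show "x \<le> \<alpha>"
  proof (rule ccontr)
    assume "\<not> x \<le> \<alpha>"
    then have "\<alpha> \<le> x" by simp
    then obtain d where d: "x = \<alpha> + d" using ordinal_le_imp_ex_add by blast
    with x have "d = 0" by simp
    with d \<open>\<not> x \<le> \<alpha>\<close> show False by simp
  qed
next
  have "\<alpha> < \<alpha> + 1"
    using ordinal_add_strict_mono_right[of 0 1 \<alpha>] by simp
  then show "x \<le> \<alpha> \<Longrightarrow> x < \<alpha> + 1" by simp
qed

lemma ordinal_add_one_le_iff [simp]: "\<alpha> + 1 \<le> x \<longleftrightarrow> (\<alpha> :: 'a::infinite ordinal) < x"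
  by (meson not_less ordinal_less_add_one_iff)

lemma limit_add_one_less: "is_limit \<kappa> \<Longrightarrow> \<delta> < \<kappa> \<Longrightarrow> \<delta> + 1 < \<kappa>"
  by (metis is_limit_def order.not_eq_order_implies_strict ordinal_add_one_le_iff)


subsection \<open>Truncated subtraction\<close>

text \<open>
  The least \<open>\<delta>\<close> with \<open>x \<le> c + \<delta>\<close>. Unlike the difference, it is total, being \<open>0\<close> when \<open>x \<le> c\<close>, and
  it is left adjoint to addition of \<open>c\<close> on the left, from which every estimate below follows.
\<close>

definition tsub :: "'a::infinite ordinal \<Rightarrow> 'a ordinal \<Rightarrow> 'a ordinal"  (infixl \<open>\<ominus>\<close> 65) where
  "x \<ominus> c = (LEAST \<delta>. x \<le> c + \<delta>)"

lemma tsub_le_iff: "x \<ominus> c \<le> \<delta> \<longleftrightarrow> x \<le> c + \<delta>"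
proof
  have "x \<le> c + (x \<ominus> c)"
    unfolding tsub_def by (rule LeastI[of _ x]) simp
  then show "x \<ominus> c \<le> \<delta> \<Longrightarrow> x \<le> c + \<delta>"
    using order_trans ordinal_add_le_cancel by blast
qed (simp add: tsub_def Least_le)

lemma less_tsub_iff: "\<delta> < x \<ominus> c \<longleftrightarrow> c + \<delta> < x"
  by (meson not_less tsub_le_iff)

lemma le_add_tsub: "x \<le> c + (x \<ominus> c)"
  by (simp flip: tsub_le_iff)

lemma add_tsub_cancel [simp]: "(c + x) \<ominus> c = x"
  using le_add_tsub[of "c + x" c] by (intro order_antisym) (simp_all add: tsub_le_iff)

lemma tsub_eq_zero [simp]: "x \<le> c \<Longrightarrow> x \<ominus> c = 0"
  using tsub_le_iff[of x c 0] by simp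

lemma add_tsub: "c \<le> x \<Longrightarrow> c + (x \<ominus> c) = x"
  using ordinal_le_imp_ex_add by fastforce

lemma ord_diff_eq_tsub: "c \<le> x \<Longrightarrow> ord_diff x c = x \<ominus> c"
  unfolding ord_diff_def by (rule the_equality) (auto simp: add_tsub)

lemma tsub_mono: "x \<le> y \<Longrightarrow> x \<ominus> c \<le> y \<ominus> c"
  by (meson le_add_tsub order_trans tsub_le_iff)

lemma tsub_antimono: "c \<le> d \<Longrightarrow> x \<ominus> d \<le> x \<ominus> c"
  by (meson le_add_tsub order_trans ordinal_add_mono_left tsub_le_iff)

lemma tsub_strict_mono: "x < y \<Longrightarrow> c < y \<Longrightarrow> x \<ominus> c < y \<ominus> c"
  by (metis add_tsub less_tsub_iff linear tsub_eq_zero add_0_right)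

lemma tsub_triangle: "x \<ominus> c \<le> (d \<ominus> c) + (x \<ominus> d)"
proof -
  have "x \<le> d + (x \<ominus> d)" by (rule le_add_tsub)
  also have "\<dots> \<le> (c + (d \<ominus> c)) + (x \<ominus> d)"
    by (rule ordinal_add_mono_left[OF le_add_tsub])
  finally show ?thesis by (simp add: tsub_le_iff add.assoc)
qed


subsection \<open>Powers of \<open>\<omega>\<close>\<close>

lemma
  shows limit_omega: "is_limit (\<omega> :: 'a::infinite ordinal)"
    and omega_le: "is_limit \<kappa> \<Longrightarrow> \<omega> \<le> \<kappa>"
proof -
  obtain b :: "'a ordinal" where b: "\<forall>n. ((\<lambda>x. x + 1) ^^ n) 0 < b"
    using ex_bound_sequence[of "\<lambda>n. ((\<lambda>x. x + 1) ^^ n) 0"] by blast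
  define s where "s = (LEAST b :: 'a ordinal. \<forall>n. ((\<lambda>x. x + 1) ^^ n) 0 < b)"
  have s: "((\<lambda>x. x + 1) ^^ n) 0 < s" for n
    unfolding s_def by (rule LeastI2[where P="\<lambda>b. \<forall>n. ((\<lambda>x. x + 1) ^^ n) 0 < b"]) (use b in auto)
  have "is_limit s"
    unfolding is_limit_def
  proof (intro conjI notI; (elim exE)?)
    assume "s = 0"
    with s[of 0] show False by simp
  next
    fix \<delta> assume \<delta>: "s = \<delta> + 1"
    have "((\<lambda>x. x + 1) ^^ n) 0 < \<delta>" for n
      using s[of "Suc n"] by (simp add: \<delta>)
    then have "s \<le> \<delta>"
      unfolding s_def by (intro Least_le) blast
    then show False using \<delta> by (metis ordinal_less_add_one_iff less_irrefl le_less_trans order_refl)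
  qed
  then show "is_limit (\<omega> :: 'a ordinal)"
    unfolding omega_def by (rule LeastI)
  show "is_limit \<kappa> \<Longrightarrow> \<omega> \<le> \<kappa>"
    unfolding omega_def by (rule Least_le)
qed

lemma omega_pos [simp]: "0 < (\<omega> :: 'a::infinite ordinal)"
  using limit_omega by (auto simp: is_limit_def ordinal_pos_iff)

lemma less_omega_cases:
  assumes "x < (\<omega> :: 'a::infinite ordinal)"
  obtains "x = 0" | y where "y < \<omega>" "x = y + 1"
proof -
  have "\<not> is_limit x" using omega_le assms by (meson not_less)
  then consider "x = 0" | y where "x = y + 1" by (auto simp: is_limit_def)
  then show thesis
  proof cases
    case 2
    then have "y < x" by simp
    from that(2)[OF less_trans[OF this assms] 2] show ?thesis .
  qed (rule that(1))
qed

lemma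
  fixes \<alpha> \<beta> :: "'a::infinite ordinal"
  shows times_ge: "\<delta> < \<beta> \<Longrightarrow> \<alpha> * \<delta> + \<alpha> \<le> \<alpha> * \<beta>"
    and times_least: "(\<And>\<delta>. \<delta> < \<beta> \<Longrightarrow> \<alpha> * \<delta> + \<alpha> \<le> \<gamma>) \<Longrightarrow> \<alpha> * \<beta> \<le> \<gamma>"
proof -
  obtain b where b: "\<forall>\<delta><\<beta>. \<alpha> * \<delta> + \<alpha> < b"
    using ex_bound_segment[of \<beta> "\<lambda>\<delta>. \<alpha> * \<delta> + \<alpha>"] by blast
  have "\<forall>\<delta>. \<delta> < \<beta> \<longrightarrow> \<alpha> * \<delta> + \<alpha> \<le> \<alpha> * \<beta>"
    unfolding times_ordinal.simps[of \<alpha> \<beta>]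
    by (rule LeastI[of "\<lambda>\<gamma>. \<forall>\<delta>. \<delta> < \<beta> \<longrightarrow> \<alpha> * \<delta> + \<alpha> \<le> \<gamma>" b])
      (use b less_imp_le in blast)
  then show "\<delta> < \<beta> \<Longrightarrow> \<alpha> * \<delta> + \<alpha> \<le> \<alpha> * \<beta>" by blast
  show "\<alpha> * \<beta> \<le> \<gamma>" if "\<And>\<delta>. \<delta> < \<beta> \<Longrightarrow> \<alpha> * \<delta> + \<alpha> \<le> \<gamma>"
    unfolding times_ordinal.simps[of \<alpha> \<beta>] by (rule Least_le) (use that in auto)
qed

lemma times_zero [simp]: "\<alpha> * 0 = (0 :: 'a::infinite ordinal)"
  using times_least[of 0 \<alpha> 0] by simp

lemma times_add_one: "\<alpha> * (\<beta> + 1) = \<alpha> * \<beta> + (\<alpha> :: 'a::infinite ordinal)"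
proof (rule order_antisym)
  show "\<alpha> * (\<beta> + 1) \<le> \<alpha> * \<beta> + \<alpha>"
  proof (rule times_least)
    fix \<delta> assume "\<delta> < \<beta> + 1"
    then consider "\<delta> = \<beta>" | "\<delta> < \<beta>" using le_less by auto
    then show "\<alpha> * \<delta> + \<alpha> \<le> \<alpha> * \<beta> + \<alpha>"
    proof cases
      case 2
      then show ?thesis
        using times_ge order_trans ordinal_add_ge_left by blast
    qed simp
  qed
  show "\<alpha> * \<beta> + \<alpha> \<le> \<alpha> * (\<beta> + 1)"
    by (rule times_ge) simp
qed

lemma times_omega_ge: "\<alpha> \<le> \<alpha> * (\<omega> :: 'a::infinite ordinal)"
  using times_ge[of 0 \<omega> \<alpha>] by simp

lemma less_times_omegaE:
  assumes "x < \<alpha> * (\<omega> :: 'a::infinite ordinal)"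
  obtains \<delta> where "\<delta> < \<omega>" "x < \<alpha> * \<delta>"
proof -
  obtain \<delta> where "\<delta> < \<omega>" "x < \<alpha> * \<delta> + \<alpha>"
    using times_least[of \<omega> \<alpha> x] assms by (meson not_less)
  then show thesis
    using that[of "\<delta> + 1"] limit_add_one_less[OF limit_omega] by (metis times_add_one)
qed

text \<open>
  The induction on \<open>d\<close> computes with multiples \<open>\<alpha> * \<delta>\<close> as if \<open>\<delta>\<close> were a natural number, which is
  possible because every nonzero ordinal below \<open>\<omega>\<close> is a successor.
\<close>

lemma times_finite_add_less:
  assumes "\<delta> < \<omega>" "y < \<alpha> * (\<omega> :: 'a::infinite ordinal)"
  shows "\<alpha> * \<delta> + y < \<alpha> * \<omega>"
proof -
  have "\<alpha> * \<delta> + \<alpha> * d \<le> \<alpha> * \<omega>" if "d < \<omega>" for d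
  proof -
    have "\<exists>e<\<omega>. \<alpha> * \<delta> + \<alpha> * d = \<alpha> * e"
      using that
    proof (induction d rule: less_induct)
      case (less d)
      from less.prems show ?case
      proof (cases rule: less_omega_cases)
        case 1
        then show ?thesis using assms(1) by auto
      next
        case (2 d')
        then obtain e where e: "e < \<omega>" "\<alpha> * \<delta> + \<alpha> * d' = \<alpha> * e"
          using less.IH[of d'] by auto
        have "\<alpha> * \<delta> + \<alpha> * d = \<alpha> * (e + 1)"
          by (simp add: 2 times_add_one e(2) flip: add.assoc)
        then show ?thesis using limit_add_one_less[OF limit_omega e(1)] by blast
      qed
    qed
    then show ?thesis using times_ge order_trans ordinal_add_ge_left by metis
  qed
  moreover obtain d where "d < \<omega>" "y < \<alpha> * d"
    using assms(2) by (rule less_times_omegaE)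
  ultimately show ?thesis
    by (meson less_le_trans ordinal_add_less_cancel)
qed

lemma add_less_times_omega:
  assumes "x < \<alpha> * (\<omega> :: 'a::infinite ordinal)" "y < \<alpha> * \<omega>"
  shows "x + y < \<alpha> * \<omega>"
proof -
  obtain d where "d < \<omega>" "x < \<alpha> * d"
    using assms(1) by (rule less_times_omegaE)
  then show ?thesis
    using times_finite_add_less[OF _ assms(2), of d] ordinal_add_mono_left[of x "\<alpha> * d" y]
    by (metis le_less_trans less_imp_le)
qed

lemma
  fixes \<xi> :: "'a::infinite ordinal"
  shows omega_pow_pos [simp]: "0 < omega_pow \<xi>"
    and omega_pow_times_omega_le: "\<delta> < \<xi> \<Longrightarrow> omega_pow \<delta> * \<omega> \<le> omega_pow \<xi>"
    and omega_pow_least: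
      "\<gamma> \<noteq> 0 \<Longrightarrow> (\<And>\<delta>. \<delta> < \<xi> \<Longrightarrow> omega_pow \<delta> * \<omega> \<le> \<gamma>) \<Longrightarrow> omega_pow \<xi> \<le> \<gamma>"
proof -
  obtain b where b: "\<forall>\<delta><\<xi>. omega_pow \<delta> * \<omega> < b"
    using ex_bound_segment[of \<xi> "\<lambda>\<delta>. omega_pow \<delta> * \<omega>"] by blast
  have "1 \<le> omega_pow \<xi> \<and> (\<forall>\<delta>. \<delta> < \<xi> \<longrightarrow> omega_pow \<delta> * \<omega> \<le> omega_pow \<xi>)"
    unfolding omega_pow.simps[of \<xi>]
    by (rule LeastI[of "\<lambda>\<gamma>. 1 \<le> \<gamma> \<and> (\<forall>\<delta>. \<delta> < \<xi> \<longrightarrow> omega_pow \<delta> * \<omega> \<le> \<gamma>)" "max 1 b"])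
      (use b in \<open>auto simp: le_max_iff_disj intro: less_imp_le\<close>)
  then show "0 < omega_pow \<xi>" "\<delta> < \<xi> \<Longrightarrow> omega_pow \<delta> * \<omega> \<le> omega_pow \<xi>"
    by (auto simp: ordinal_pos_iff)
  show "omega_pow \<xi> \<le> \<gamma>" if "\<gamma> \<noteq> 0" "\<And>\<delta>. \<delta> < \<xi> \<Longrightarrow> omega_pow \<delta> * \<omega> \<le> \<gamma>"
    unfolding omega_pow.simps[of \<xi>] by (rule Least_le) (use that in auto)
qed

lemma omega_pow_neq_zero [simp]: "omega_pow \<xi> \<noteq> 0"
  using omega_pow_pos[of \<xi>] by (auto simp: ordinal_pos_iff)

lemma omega_pow_zero [simp]: "omega_pow 0 = (1 :: 'a::infinite ordinal)"
  by (rule order_antisym[OF omega_pow_least]) simp_all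

lemma omega_pow_add_one: "omega_pow (\<xi> + 1) = omega_pow \<xi> * (\<omega> :: 'a::infinite ordinal)"
proof (rule order_antisym)
  show "omega_pow (\<xi> + 1) \<le> omega_pow \<xi> * \<omega>"
  proof (rule omega_pow_least)
    show "omega_pow \<xi> * \<omega> \<noteq> 0"
      using times_omega_ge[of "omega_pow \<xi>"] by auto
    fix \<delta> assume "\<delta> < \<xi> + 1"
    then consider "\<delta> = \<xi>" | "\<delta> < \<xi>" using le_less by auto
    then show "omega_pow \<delta> * \<omega> \<le> omega_pow \<xi> * \<omega>"
    proof cases
      case 2
      then show ?thesis
        using omega_pow_times_omega_le order_trans times_omega_ge by blast
    qed simp
  qed
  show "omega_pow \<xi> * \<omega> \<le> omega_pow (\<xi> + 1)"
    by (rule omega_pow_times_omega_le) simp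
qed

lemma times_finite_less_times_omega:
  "\<alpha> \<noteq> 0 \<Longrightarrow> \<delta> < \<omega> \<Longrightarrow> \<alpha> * \<delta> < \<alpha> * (\<omega> :: 'a::infinite ordinal)"
  by (metis add_0_right less_le_trans ordinal_add_less_cancel ordinal_pos_iff times_ge)

lemma omega_pow_strict_mono:
  assumes "\<xi> < (\<rho> :: 'a::infinite ordinal)"
  shows "omega_pow \<xi> < omega_pow \<rho>"
proof -
  have "omega_pow \<xi> * 1 < omega_pow \<xi> * \<omega>"
    by (rule times_finite_less_times_omega)
      (use limit_add_one_less[OF limit_omega omega_pos] in simp_all)
  moreover have "omega_pow \<xi> * 1 = omega_pow \<xi>"
    using times_add_one[of "omega_pow \<xi>" 0] by simp
  ultimately show ?thesis
    using omega_pow_times_omega_le[OF assms] by (metis less_le_trans)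
qed

lemma omega_pow_less_iff [simp]: "omega_pow \<xi> < omega_pow \<rho> \<longleftrightarrow> \<xi> < (\<rho> :: 'a::infinite ordinal)"
  by (metis linorder_neqE omega_pow_strict_mono order_less_asym)

lemma le_omega_pow: "\<xi> \<le> omega_pow (\<xi> :: 'a::infinite ordinal)"
proof (induction \<xi> rule: less_induct)
  case (less \<xi>)
  show ?case
  proof (rule ccontr)
    assume "\<not> \<xi> \<le> omega_pow \<xi>"
    then have *: "omega_pow \<xi> < \<xi>" by simp
    from less[OF this] show False using * by (metis not_less omega_pow_less_iff)
  qed
qed

lemma less_omega_pow_limitE:
  assumes "is_limit \<xi>" "x < omega_pow \<xi>"
  obtains \<rho> where "\<rho> < \<xi>" "x < omega_pow \<rho>"
proof (cases "x = 0")
  case True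
  then show thesis using that[of 0] assms(1) by (simp add: is_limit_def ordinal_pos_iff)
next
  case False
  then obtain \<delta> where "\<delta> < \<xi>" "x < omega_pow \<delta> * \<omega>"
    using omega_pow_least[of x \<xi>] assms(2) by (meson not_less)
  then show thesis
    using that[of "\<delta> + 1"] limit_add_one_less[OF assms(1)] by (metis omega_pow_add_one)
qed

text \<open>Powers of \<open>\<omega>\<close> are additively indecomposable, hence absorb smaller ordinals from the left.\<close>

lemma add_less_omega_pow:
  assumes "x < omega_pow \<xi>" "y < omega_pow (\<xi> :: 'a::infinite ordinal)"
  shows "x + y < omega_pow \<xi>"
proof -
  consider "\<xi> = 0" | \<rho> where "\<xi> = \<rho> + 1" | "is_limit \<xi>"
    by (auto simp: is_limit_def)
  then show ?thesis
  proof cases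
    case 1
    then show ?thesis using assms by simp
  next
    case 2
    then show ?thesis using assms by (simp add: omega_pow_add_one add_less_times_omega)
  next
    case 3
    obtain \<rho> where \<rho>: "\<rho> < \<xi>" "x < omega_pow \<rho>" using less_omega_pow_limitE[OF 3 assms(1)] .
    obtain \<sigma> where \<sigma>: "\<sigma> < \<xi>" "y < omega_pow \<sigma>" using less_omega_pow_limitE[OF 3 assms(2)] .
    define \<tau> where "\<tau> = max \<rho> \<sigma>"
    have "\<rho> < \<tau> + 1" "\<sigma> < \<tau> + 1"
      by (simp_all add: \<tau>_def)
    then have "x < omega_pow (\<tau> + 1)" "y < omega_pow (\<tau> + 1)"
      using \<rho>(2) \<sigma>(2) omega_pow_strict_mono less_trans by blast+
    then have "x + y < omega_pow (\<tau> + 1)"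
      by (simp add: omega_pow_add_one add_less_times_omega)
    also have "\<tau> + 1 < \<xi>"
      using \<rho>(1) \<sigma>(1) by (simp add: \<tau>_def limit_add_one_less 3)
    then have "omega_pow (\<tau> + 1) < omega_pow \<xi>" by simp
    finally show ?thesis .
  qed
qed

lemma add_omega_pow_absorb:
  assumes "x < omega_pow (\<xi> :: 'a::infinite ordinal)" "omega_pow \<xi> \<le> y"
  shows "x + y = y"
proof -
  have "x + omega_pow \<xi> = omega_pow \<xi>"
    by (rule order_antisym[OF ordinal_add_least])
      (use assms(1) in \<open>auto intro: add_less_omega_pow\<close>)
  then show ?thesis
    using assms(2) by (metis add.assoc ordinal_le_imp_ex_add)
qed

lemma ordinal_leading_power:
  assumes "x \<noteq> (0 :: 'a::infinite ordinal)"
  obtains \<xi> where "omega_pow \<xi> \<le> x" "x < omega_pow (\<xi> + 1)"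
proof -
  define \<rho> where "\<rho> = (LEAST \<rho>. x < omega_pow \<rho>)"
  have "x < omega_pow (x + 1)"
    using le_omega_pow[of "x + 1"] by simp
  then have x: "x < omega_pow \<rho>"
    unfolding \<rho>_def by (rule LeastI)
  have least: "omega_pow \<sigma> \<le> x" if "\<sigma> < \<rho>" for \<sigma>
    using not_less_Least that unfolding \<rho>_def by (meson not_less)
  consider "\<rho> = 0" | \<sigma> where "\<rho> = \<sigma> + 1" | "is_limit \<rho>"
    by (auto simp: is_limit_def)
  then show thesis
  proof cases
    case 1
    with x assms show ?thesis by simp
  next
    case (2 \<sigma>)
    then show ?thesis using that[of \<sigma>] x least[of \<sigma>] by simp
  next
    case 3
    obtain \<sigma> where "\<sigma> < \<rho>" "x < omega_pow \<sigma>"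
      using less_omega_pow_limitE[OF 3 x] .
    then show ?thesis using least[of \<sigma>] by simp
  qed
qed

text \<open>
  This makes the recursion for normal forms terminate: if the remainder were \<open>x\<close> itself, then
  \<open>omega_pow \<xi>\<close> could be added to the left of \<open>x\<close> indefinitely, so that \<open>x\<close> would not lie below
  \<open>omega_pow (\<xi> + 1)\<close>.
\<close>

lemma ordinal_leading_remainder:
  assumes "omega_pow \<xi> \<le> x" "x < omega_pow (\<xi> + 1)"
  obtains y where "x = omega_pow \<xi> + y" "y < (x :: 'a::infinite ordinal)"
proof -
  obtain y where y: "x = omega_pow \<xi> + y"
    using ordinal_le_imp_ex_add[OF assms(1)] by blast
  have "y \<noteq> x"
  proof
    assume yx: "y = x"
    obtain \<delta> where "\<delta> < \<omega>" "x < omega_pow \<xi> * \<delta>"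
      using assms(2) unfolding omega_pow_add_one by (rule less_times_omegaE)
    moreover have "omega_pow \<xi> * \<delta> \<le> x" if "\<delta> < \<omega>" for \<delta>
    proof -
      have "omega_pow \<xi> * \<delta> + x = x"
        using that
      proof (induction \<delta> rule: less_induct)
        case (less \<delta>)
        from less.prems show ?case
        proof (cases rule: less_omega_cases)
          case (2 \<delta>')
          then have "omega_pow \<xi> * \<delta> + x = omega_pow \<xi> * \<delta>' + (omega_pow \<xi> + x)"
            by (simp add: times_add_one add.assoc)
          also have "omega_pow \<xi> + x = x" using y unfolding yx by (rule sym)
          finally show ?thesis using less.IH[of \<delta>'] 2 by simp
        qed simp
      qed
      then show ?thesis by (metis ordinal_add_ge_left)
    qed
    ultimately show False by (meson not_less)
  qed
  moreover have "y \<le> x" by (simp add: y)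
  ultimately have "y < x" by (simp add: less_le)
  with y show thesis by (rule that)
qed

section \<open>Normal forms as multisets of exponents\<close>

lemma sum_omega_pows_simps [simp]:
  "sum_omega_pows [] = 0"
  "sum_omega_pows (\<xi> # \<xi>s) = omega_pow \<xi> + sum_omega_pows \<xi>s"
  by (simp_all add: sum_omega_pows_def)

lemma sum_omega_pows_append: "sum_omega_pows (xs @ ys) = sum_omega_pows xs + sum_omega_pows ys"
  by (induction xs) (simp_all add: add.assoc)

lemma sum_omega_pows_less: "(\<And>x. x \<in> set xs \<Longrightarrow> x < \<xi>) \<Longrightarrow> sum_omega_pows xs < omega_pow \<xi>"
  by (induction xs) (simp_all add: add_less_omega_pow)

text \<open>
  A multiset of exponents carries the same information as a non-increasing list of exponents, but its
  addition is the natural sum and, as shown below, its standard order is the order of the ordinals.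
  All comparisons of natural sums are therefore made in the ordered monoid of multisets.
\<close>

definition of_exponents :: "'a::infinite ordinal multiset \<Rightarrow> 'a ordinal" where
  "of_exponents M = sum_omega_pows (rev (sorted_list_of_multiset M))"

definition exponents :: "'a::infinite ordinal \<Rightarrow> 'a ordinal multiset" where
  "exponents \<zeta> = mset (nf_exponents \<zeta>)"

lemma of_exponents_empty [simp]: "of_exponents {#} = 0"
  by (simp add: of_exponents_def)

lemma of_exponents_single [simp]: "of_exponents {#\<xi>#} = omega_pow \<xi>"
  by (simp add: of_exponents_def)

lemma of_exponents_mset: "sorted_wrt (\<ge>) xs \<Longrightarrow> of_exponents (mset xs) = sum_omega_pows xs"
proof -
  assume "sorted_wrt (\<ge>) xs"
  then have "sorted (rev xs)" by (simp add: sorted_wrt_rev)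
  then have "sorted_list_of_multiset (mset (rev xs)) = rev xs"
    unfolding sorted_list_of_multiset_mset by (rule sorted_sort_id)
  then show ?thesis by (simp add: of_exponents_def)
qed

lemma of_exponents_union:
  assumes "\<And>x y. x \<in># M \<Longrightarrow> y \<in># N \<Longrightarrow> y \<le> x"
  shows "of_exponents (M + N) = of_exponents M + of_exponents N"
proof -
  let ?xs = "rev (sorted_list_of_multiset M) @ rev (sorted_list_of_multiset N)"
  have "sorted_wrt (\<ge>) ?xs"
    using assms by (auto simp: sorted_wrt_append sorted_wrt_rev)
  then have "of_exponents (mset ?xs) = sum_omega_pows ?xs"
    by (rule of_exponents_mset)
  then show ?thesis by (simp add: of_exponents_def sum_omega_pows_append)
qed

lemma of_exponents_add_mset:
  "(\<And>x. x \<in># M \<Longrightarrow> x \<le> \<xi>) \<Longrightarrow> of_exponents (add_mset \<xi> M) = omega_pow \<xi> + of_exponents M"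
  using of_exponents_union[of "{#\<xi>#}" M] by simp

lemma of_exponents_less: "(\<And>x. x \<in># M \<Longrightarrow> x < \<xi>) \<Longrightarrow> of_exponents M < omega_pow \<xi>"
  unfolding of_exponents_def by (rule sum_omega_pows_less) simp

text \<open>
  Compare largest elements: if they differ, a power of \<open>\<omega>\<close> lies between the two values; if they
  agree, both normal forms start with the same summand, which can be removed.
\<close>

lemma of_exponents_strict_mono:
  "M < N \<Longrightarrow> of_exponents M < of_exponents (N :: 'a::infinite ordinal multiset)"
proof (induction M arbitrary: N rule: measure_induct_rule[where f=size])
  case (less M)
  from less.prems have "N \<noteq> {#}" by auto
  define a where "a = Max_mset N"
  define N' where "N' = N - {#a#}"
  have a: "a \<in># N" "\<And>x. x \<in># N \<Longrightarrow> x \<le> a"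
    using \<open>N \<noteq> {#}\<close> by (simp_all add: a_def)
  then have N: "N = add_mset a N'" by (simp add: N'_def)
  have val_N: "of_exponents N = omega_pow a + of_exponents N'"
    unfolding N by (rule of_exponents_add_mset) (use a(2) N in auto)
  show ?case
  proof (cases "\<forall>x\<in>#M. x < a")
    case True
    then have "of_exponents M < omega_pow a" by (intro of_exponents_less) blast
    also have "\<dots> \<le> of_exponents N" unfolding val_N by simp
    finally show ?thesis .
  next
    case False
    then obtain m where m: "m \<in># M" "a \<le> m" by (auto simp: not_less)
    have le: "x \<le> a" if "x \<in># M" for x
    proof (rule ccontr)
      assume "\<not> x \<le> a"
      then have "\<forall>y\<in>#N. y < x" using a(2) by (auto simp: not_le intro: le_less_trans)
      then have "N < M" using that by (intro ex_gt_imp_less_multiset) blast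
      with less.prems show False by simp
    qed
    with m have "a \<in># M" using order_antisym by blast
    then obtain M' where M: "M = add_mset a M'" by (metis mset_add)
    have "M' < N'" using less.prems unfolding M N by simp
    then have "of_exponents M' < of_exponents N'"
      by (intro less.IH) (simp_all add: M)
    moreover have "of_exponents M = omega_pow a + of_exponents M'"
      unfolding M by (rule of_exponents_add_mset) (use le M in auto)
    ultimately show ?thesis using val_N by simp
  qed
qed

lemma of_exponents_less_iff [simp]: "of_exponents M < of_exponents N \<longleftrightarrow> M < N"
  by (metis linorder_neqE of_exponents_strict_mono order_less_asym)

lemma of_exponents_le_iff [simp]: "of_exponents M \<le> of_exponents N \<longleftrightarrow> M \<le> N"
  by (meson not_less of_exponents_less_iff)

lemma of_exponents_eq_iff [simp]: "of_exponents M = of_exponents N \<longleftrightarrow> M = N"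
  by (simp add: order.eq_iff)

lemma omega_pow_le_of_exponents: "\<xi> \<in># M \<Longrightarrow> omega_pow \<xi> \<le> of_exponents M"
  using of_exponents_le_iff[of "{#\<xi>#}" M] subset_eq_imp_le_multiset[of "{#\<xi>#}" M] by simp

lemma ex_of_exponents: "\<exists>M. of_exponents M = (x :: 'a::infinite ordinal)"
proof (induction x rule: less_induct)
  case (less x)
  show ?case
  proof (cases "x = 0")
    case True
    then show ?thesis using of_exponents_empty by metis
  next
    case False
    then obtain \<xi> where \<xi>: "omega_pow \<xi> \<le> x" "x < omega_pow (\<xi> + 1)"
      by (rule ordinal_leading_power)
    then obtain y where y: "x = omega_pow \<xi> + y" "y < x"
      by (rule ordinal_leading_remainder)
    from less[OF y(2)] obtain M where M: "of_exponents M = y" by blast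
    have "z \<le> \<xi>" if "z \<in># M" for z
    proof -
      have "omega_pow z \<le> y" using omega_pow_le_of_exponents[OF that] M by simp
      then have "omega_pow z < omega_pow (\<xi> + 1)" using y(2) \<xi>(2) by (meson le_less_trans less_trans)
      then show ?thesis by simp
    qed
    then have "of_exponents (add_mset \<xi> M) = x"
      by (simp add: of_exponents_add_mset M y(1))
    then show ?thesis by blast
  qed
qed

lemma nf_exponents_of_exponents:
  "nf_exponents (of_exponents M) = rev (sorted_list_of_multiset M)"
  unfolding nf_exponents_def
proof (rule the_equality)
  show "sorted_wrt (\<ge>) (rev (sorted_list_of_multiset M)) \<and>
      sum_omega_pows (rev (sorted_list_of_multiset M)) = of_exponents M"
    by (simp add: sorted_wrt_rev of_exponents_def)
  fix xs assume xs: "sorted_wrt (\<ge>) xs \<and> sum_omega_pows xs = of_exponents M"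
  then have "of_exponents (mset xs) = of_exponents M"
    by (simp add: of_exponents_mset)
  then have "sorted_list_of_multiset M = sort (rev xs)"
    by (simp add: flip: sorted_list_of_multiset_mset)
  moreover have "sort (rev xs) = rev xs"
    using xs by (intro sorted_sort_id) (simp add: sorted_wrt_rev)
  ultimately show "xs = rev (sorted_list_of_multiset M)" by simp
qed

lemma exponents_of_exponents [simp]: "exponents (of_exponents M) = M"
  by (simp add: exponents_def nf_exponents_of_exponents)

lemma of_exponents_exponents [simp]: "of_exponents (exponents x) = x"
  using ex_of_exponents[of x] by auto

lemma exponents_less_iff: "exponents x < exponents y \<longleftrightarrow> x < y"
  by (simp flip: of_exponents_less_iff)

lemma exponents_le_iff: "exponents x \<le> exponents y \<longleftrightarrow> x \<le> y"
  by (simp flip: of_exponents_le_iff)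

lemma exponents_eq_iff: "exponents x = exponents y \<longleftrightarrow> x = y"
  by (simp flip: of_exponents_eq_iff)

lemma exponents_zero [simp]: "exponents 0 = {#}"
  by (simp flip: of_exponents_eq_iff)

lemma exponents_eq_empty_iff [simp]: "exponents x = {#} \<longleftrightarrow> x = 0"
  by (simp flip: of_exponents_eq_iff)

lemma exponents_omega_pow [simp]: "exponents (omega_pow \<xi>) = {#\<xi>#}"
  by (simp flip: of_exponents_eq_iff)

lemma exponents_one [simp]: "exponents 1 = {#0#}"
  using exponents_omega_pow[of 0] by simp

lemma exponents_less_single_iff: "exponents x < {#\<xi>#} \<longleftrightarrow> x < omega_pow \<xi>"
  using exponents_less_iff[of x "omega_pow \<xi>"] by simp

lemma exponents_nat_sum [simp]: "exponents (x \<oplus> y) = exponents x + exponents y"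
proof -
  have "sort (nf_exponents x @ nf_exponents y) =
      sorted_list_of_multiset (exponents x + exponents y)"
    unfolding exponents_def by (simp flip: sorted_list_of_multiset_mset)
  then have "x \<oplus> y = of_exponents (exponents x + exponents y)"
    unfolding nat_sum_def of_exponents_def by simp
  then show ?thesis by simp
qed

lemma exponents_nat_sum_list: "exponents (nat_sum_list xs) = sum_list (map exponents xs)"
  by (induction xs) (simp_all add: nat_sum_list_def)

lemma exponents_add_le: "exponents (x + y) \<le> exponents x + exponents y"
proof -
  have "x + y \<le> of_exponents (exponents x + exponents y)"
  proof (induction y rule: less_induct)
    case (less y)
    show ?case
    proof (rule ordinal_add_least)
      show "x \<le> of_exponents (exponents x + exponents y)"
        by (simp flip: exponents_le_iff)
      fix \<delta> assume \<delta>: "\<delta> < y"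
      have "of_exponents (exponents x + exponents \<delta>) < of_exponents (exponents x + exponents y)"
        using \<delta> by (simp add: exponents_less_iff)
      with less[OF \<delta>] show "x + \<delta> < of_exponents (exponents x + exponents y)"
        by (rule le_less_trans)
    qed
  qed
  then show ?thesis by (simp flip: exponents_le_iff)
qed

lemma exponents_add_eq:
  assumes "\<And>x y. x \<in># exponents \<alpha> \<Longrightarrow> y \<in># exponents \<beta> \<Longrightarrow> y \<le> x"
  shows "exponents (\<alpha> + \<beta>) = exponents \<alpha> + exponents \<beta>"
  using of_exponents_union[OF assms] by (metis exponents_of_exponents of_exponents_exponents)

lemma nat_sum_one: "\<xi> \<oplus> 1 = \<xi> + (1 :: 'a::infinite ordinal)"
proof -
  have "exponents (\<xi> \<oplus> 1) = exponents (\<xi> + 1)"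
    by (subst exponents_add_eq) auto
  then show ?thesis by (simp only: exponents_eq_iff)
qed

lemma one_times: "1 * \<beta> = (\<beta> :: 'a::infinite ordinal)"
proof (induction \<beta> rule: less_induct)
  case (less \<beta>)
  show ?case
  proof (rule order_antisym)
    show "1 * \<beta> \<le> \<beta>" by (rule times_least) (simp add: less)
    show "\<beta> \<le> 1 * \<beta>"
    proof (rule ccontr)
      assume "\<not> \<beta> \<le> 1 * \<beta>"
      then have "1 * \<beta> < \<beta>" by simp
      from times_ge[OF this, of 1] less[OF this] show False by simp
    qed
  qed
qed

lemma nf_exponents_omega: "nf_exponents (\<omega> :: 'a::infinite ordinal) = [1]"
proof -
  have "of_exponents {#1#} = (\<omega> :: 'a ordinal)"
    using omega_pow_add_one[of "0 :: 'a ordinal"] by (simp add: one_times)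
  then show ?thesis
    using nf_exponents_of_exponents[of "{#1 :: 'a ordinal#}"] by simp
qed

lemma exponents_nat_prod_omega:
  "exponents (x \<otimes> \<omega>) = image_mset (\<lambda>\<xi>. \<xi> + 1) (exponents x)"
proof -
  have "exponents (x \<otimes> \<omega>) = sum_list (map (\<lambda>\<xi>. {#\<xi> + 1#}) (nf_exponents x))"
    unfolding nat_prod_def exponents_nat_sum_list nf_exponents_omega
    by (simp add: comp_def nat_sum_one map_concat flip: sum_list_def)
  also have "\<dots> = image_mset (\<lambda>\<xi>. \<xi> + 1) (mset (nf_exponents x))"
    by (induction "nf_exponents x") simp_all
  finally show ?thesis by (simp add: exponents_def)
qed

lemma nf_exponents_eq: "nf_exponents x = rev (sorted_list_of_multiset (exponents x))"
  using nf_exponents_of_exponents[of "exponents x"] by simp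

lemma
  assumes "\<zeta> \<noteq> 0"
  shows exponents_nf_init:
      "exponents \<zeta> = add_mset (last (nf_exponents \<zeta>)) (exponents (nf_init \<zeta>))"
    and nf_init_add_last: "nf_init \<zeta> + omega_pow (last (nf_exponents \<zeta>)) = \<zeta>"
    and last_nf_exponents_le: "\<xi> \<in># exponents (nf_init \<zeta>) \<Longrightarrow> last (nf_exponents \<zeta>) \<le> \<xi>"
proof -
  let ?xs = "nf_exponents \<zeta>"
  have "?xs \<noteq> []"
    using assms by (metis exponents_def exponents_eq_empty_iff mset.simps(1))
  then have split: "?xs = butlast ?xs @ [last ?xs]" by simp
  have "sorted_wrt (\<ge>) ?xs"
    unfolding nf_exponents_eq by (simp add: sorted_wrt_rev)
  then have sorted: "sorted_wrt (\<ge>) (butlast ?xs)" "\<forall>\<xi>\<in>set (butlast ?xs). last ?xs \<le> \<xi>"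
    by (subst (asm) split, simp add: sorted_wrt_append)+
  have init: "exponents (nf_init \<zeta>) = mset (butlast ?xs)"
    using of_exponents_mset[OF sorted(1)] unfolding nf_init_def
    by (metis exponents_of_exponents)
  have "mset ?xs = add_mset (last ?xs) (mset (butlast ?xs))"
    by (subst split) simp
  then show "exponents \<zeta> = add_mset (last ?xs) (exponents (nf_init \<zeta>))"
    unfolding init by (simp add: exponents_def[of \<zeta>])
  then have "\<zeta> = of_exponents (exponents (nf_init \<zeta>) + {#last ?xs#})"
    using of_exponents_exponents[of \<zeta>] by simp
  also have "\<dots> = nf_init \<zeta> + omega_pow (last ?xs)"
    using sorted(2) init of_exponents_exponents[of "nf_init \<zeta>"]
    by (subst of_exponents_union) auto
  finally show "nf_init \<zeta> + omega_pow (last ?xs) = \<zeta>" by simp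
  show "\<xi> \<in># exponents (nf_init \<zeta>) \<Longrightarrow> last ?xs \<le> \<xi>"
    using sorted(2) init by simp
qed

section \<open>Shifted natural sums\<close>

abbreviation incr :: "'a::infinite ordinal multiset \<Rightarrow> 'a ordinal multiset" where
  "incr \<equiv> image_mset (\<lambda>\<xi>. \<xi> + 1)"

lemma incr_mono: "M \<le> N \<Longrightarrow> incr M \<le> incr N"
  by (rule image_mset_mono) simp_all

text \<open>
  The exponents of the natural sum of \<open>c \<otimes> \<omega>\<close> and of the \<open>x i \<ominus> c\<close> for \<open>i \<in> I\<close>. With \<open>c = zeta x\<close> this is
  the second clause of the infinite natural sum, and with \<open>c = nf_init (zeta x)\<close> the first one up to a
  single summand. A free base \<open>c\<close> makes the two clauses, and the values of two sequences with
  different \<open>zeta\<close>, comparable.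
\<close>

definition shifted_sum ::
    "'a::infinite ordinal \<Rightarrow> (nat \<Rightarrow> 'a ordinal) \<Rightarrow> nat set \<Rightarrow> 'a ordinal multiset" where
  "shifted_sum c x I = incr (exponents c) + (\<Sum>i\<in>I. exponents (x i \<ominus> c))"

lemma shifted_sum_support:
  assumes "finite I" "{i. c < x i} \<subseteq> I"
  shows "shifted_sum c x I = shifted_sum c x {i. c < x i}"
proof -
  have "(\<Sum>i\<in>I. exponents (x i \<ominus> c)) = (\<Sum>i\<in>{i. c < x i}. exponents (x i \<ominus> c))"
    by (rule sum.mono_neutral_right) (use assms in \<open>auto simp: not_less\<close>)
  then show ?thesis by (simp add: shifted_sum_def)
qed

lemma shifted_sum_mono:
  assumes "\<And>i. i \<in> I \<Longrightarrow> x i \<le> y i"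
  shows "shifted_sum c x I \<le> shifted_sum c y I"
  unfolding shifted_sum_def
  by (intro add_left_mono sum_mono) (use assms in \<open>simp add: exponents_le_iff tsub_mono\<close>)

lemma shifted_sum_strict_mono:
  assumes "finite I" "\<And>i. i \<in> I \<Longrightarrow> x i \<le> y i" "j \<in> I" "x j < y j" "c < y j"
  shows "shifted_sum c x I < shifted_sum c y I"
proof -
  have "(\<Sum>i\<in>I. exponents (x i \<ominus> c)) < (\<Sum>i\<in>I. exponents (y i \<ominus> c))"
  proof (rule sum_strict_mono_ex1)
    show "\<forall>i\<in>I. exponents (x i \<ominus> c) \<le> exponents (y i \<ominus> c)"
      using assms(2) by (simp add: exponents_le_iff tsub_mono)
    show "\<exists>i\<in>I. exponents (x i \<ominus> c) < exponents (y i \<ominus> c)"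
      using assms(3-5) tsub_strict_mono by (metis exponents_less_iff)
  qed (rule assms(1))
  then show ?thesis unfolding shifted_sum_def by (rule add_strict_left_mono)
qed

lemma tsub_less: "x < c + \<delta> \<Longrightarrow> \<delta> \<noteq> 0 \<Longrightarrow> x \<ominus> c < \<delta>"
  using tsub_strict_mono[of x "c + \<delta>" c] ordinal_add_strict_mono_right[of 0 \<delta> c]
  by (simp add: ordinal_pos_iff)

text \<open>
  Let \<open>a\<close> be the leading exponent of \<open>d \<ominus> c\<close>. The exponents of \<open>c\<close> that are at least \<open>a\<close> remain in \<open>d\<close>
  and are followed by \<open>a\<close>, so \<open>d \<otimes> \<omega>\<close> gains a summand with exponent \<open>a + 1\<close>. It outweighs the
  contribution to \<open>c \<otimes> \<omega>\<close> of the other exponents of \<open>c\<close>, together with any finite number of copies of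
  \<open>d \<ominus> c\<close>: one for each difference \<open>x i \<ominus> c\<close>, and the additional one on the left.
\<close>

lemma shifted_sum_base_strict_mono:
  assumes "c < d" "finite I"
  shows "shifted_sum c x I + exponents (d \<ominus> c) < shifted_sum d x I"
proof -
  define \<delta> where "\<delta> = d \<ominus> c"
  have d: "d = c + \<delta>" using assms(1) by (simp add: \<delta>_def add_tsub)
  with assms(1) have "\<delta> \<noteq> 0" by auto
  then obtain a where a: "omega_pow a \<le> \<delta>" "\<delta> < omega_pow (a + 1)"
    by (rule ordinal_leading_power)
  define P where "P = filter_mset (\<lambda>\<xi>. a \<le> \<xi>) (exponents c)"
  define Z where "Z = filter_mset (\<lambda>\<xi>. \<not> a \<le> \<xi>) (exponents c)"
  have PZ: "exponents c = P + Z"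
    unfolding P_def Z_def by (rule multiset_partition)
  have "of_exponents (P + Z) = of_exponents P + of_exponents Z"
    by (rule of_exponents_union) (auto simp: P_def Z_def)
  then have "c = of_exponents P + of_exponents Z"
    by (simp flip: PZ)
  moreover have "of_exponents Z + \<delta> = \<delta>"
    by (rule add_omega_pow_absorb[OF of_exponents_less a(1)]) (auto simp: Z_def)
  ultimately have "d = of_exponents P + \<delta>"
    by (simp add: d add.assoc)
  moreover have "of_exponents (P + {#a#}) = of_exponents P + omega_pow a"
    by (subst of_exponents_union) (auto simp: P_def)
  ultimately have "of_exponents (P + {#a#}) \<le> of_exponents (exponents d)"
    using a(1) by simp
  then have "P + {#a#} \<le> exponents d"
    by (simp only: of_exponents_le_iff)
  from incr_mono[OF this] have base: "incr P + {#a + 1#} \<le> incr (exponents d)"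
    by simp
  have \<delta>_small: "\<xi> < a + 1" if "\<xi> \<in># exponents \<delta>" for \<xi>
    using a(2) that by (simp flip: exponents_less_single_iff)
  have "exponents (x i \<ominus> c) \<le> exponents \<delta> + exponents (x i \<ominus> d)" for i
    using exponents_add_le[of \<delta> "x i \<ominus> d"] tsub_triangle[of "x i" c d]
    by (metis \<delta>_def exponents_le_iff order_trans)
  then have "(\<Sum>i\<in>I. exponents (x i \<ominus> c)) \<le> (\<Sum>i\<in>I. exponents \<delta> + exponents (x i \<ominus> d))"
    by (intro sum_mono)
  then have diffs: "(\<Sum>i\<in>I. exponents (x i \<ominus> c)) \<le>
      (\<Sum>i\<in>I. exponents \<delta>) + (\<Sum>i\<in>I. exponents (x i \<ominus> d))"
    by (simp add: sum.distrib)
  have "incr Z + (\<Sum>i\<in>I. exponents \<delta>) + exponents \<delta> < {#a + 1#}"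
    using \<delta>_small assms(2) by (auto simp: Z_def set_mset_sum)
  then have small: "incr P + (incr Z + (\<Sum>i\<in>I. exponents \<delta>) + exponents \<delta>) < incr P + {#a + 1#}"
    by (rule add_strict_left_mono)
  have "shifted_sum c x I + exponents (d \<ominus> c)
      = incr P + incr Z + exponents \<delta> + (\<Sum>i\<in>I. exponents (x i \<ominus> c))"
    by (simp add: shifted_sum_def PZ \<delta>_def ac_simps)
  also have "\<dots> \<le> incr P + incr Z + exponents \<delta> +
      ((\<Sum>i\<in>I. exponents \<delta>) + (\<Sum>i\<in>I. exponents (x i \<ominus> d)))"
    using diffs by (rule add_left_mono)
  also have "\<dots> = incr P + (incr Z + (\<Sum>i\<in>I. exponents \<delta>) + exponents \<delta>) +
      (\<Sum>i\<in>I. exponents (x i \<ominus> d))"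
    by (simp add: ac_simps)
  also have "\<dots> < incr (exponents d) + (\<Sum>i\<in>I. exponents (x i \<ominus> d))"
    using less_le_trans[OF small base] by (rule add_strict_right_mono)
  finally show ?thesis by (simp add: shifted_sum_def)
qed

lemma shifted_sum_base_mono:
  assumes "c \<le> d" "finite I"
  shows "shifted_sum c x I \<le> shifted_sum d x I"
proof (cases "c = d")
  case False
  then have "shifted_sum c x I + exponents (d \<ominus> c) < shifted_sum d x I"
    using assms by (intro shifted_sum_base_strict_mono) simp_all
  then show ?thesis
    using le_less_trans[OF less_eq_multiset_plus_right] less_imp_le by blast
qed simp


section \<open>The infinite natural sum in terms of exponents\<close>

lemma finite_zeta: "finite {i. zeta \<alpha> < \<alpha> i}"
proof -
  obtain b where "\<forall>i. \<alpha> i < b" using ex_bound_sequence by blast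
  then have "{i. b < \<alpha> i} = {}" by (auto dest: less_asym)
  then have "finite {i. b < \<alpha> i}" by simp
  then show ?thesis unfolding zeta_def by (rule LeastI)
qed

lemma zeta_le: "finite {i. z < \<alpha> i} \<Longrightarrow> zeta \<alpha> \<le> z"
  unfolding zeta_def by (rule Least_le)

lemma infinite_less_zeta: "z < zeta \<alpha> \<Longrightarrow> infinite {i. z < \<alpha> i}"
  using zeta_le leD by blast

lemma zeta_eqI:
  assumes "finite {i. z < \<alpha> i}" "\<And>y. y < z \<Longrightarrow> infinite {i. y < \<alpha> i}"
  shows "zeta \<alpha> = z"
  by (rule order_antisym[OF zeta_le[OF assms(1)]]) (use assms(2) finite_zeta leI in blast)

lemma
  shows eps_le: "finite {i. e \<le> \<alpha> i} \<Longrightarrow> eps \<alpha> \<le> e"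
    and finite_e_special: "finite (e_special \<alpha>)"
    and zeta_le_eps: "zeta \<alpha> \<le> eps \<alpha>"
proof -
  show *: "eps \<alpha> \<le> e" if "finite {i. e \<le> \<alpha> i}" for e
    unfolding eps_def using that by (rule Least_le)
  have "finite {i. zeta \<alpha> + 1 \<le> \<alpha> i}" by (simp add: finite_zeta)
  then have "finite {i. eps \<alpha> \<le> \<alpha> i}" unfolding eps_def by (rule LeastI)
  then show "finite (e_special \<alpha>)" by (simp add: e_special_def)
  have "finite {i. eps \<alpha> < \<alpha> i}"
    by (rule finite_subset[OF _ \<open>finite {i. eps \<alpha> \<le> \<alpha> i}\<close>]) auto
  then show "zeta \<alpha> \<le> eps \<alpha>" by (rule zeta_le)
qed

lemma zeta_le_e_special: "i \<in> e_special \<alpha> \<Longrightarrow> zeta \<alpha> \<le> \<alpha> i"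
  using zeta_le_eps order_trans by (auto simp: e_special_def)

lemma zeta_less_e_special: "{i. zeta \<alpha> < \<alpha> i} \<subseteq> e_special \<alpha>"
proof -
  have "eps \<alpha> \<le> zeta \<alpha> + 1" by (rule eps_le) (simp add: finite_zeta)
  then show ?thesis unfolding e_special_def using order_trans by fastforce
qed

lemma e_special_eq: "finite {i. zeta \<alpha> \<le> \<alpha> i} \<Longrightarrow> e_special \<alpha> = {i. zeta \<alpha> \<le> \<alpha> i}"
  using eps_le[of "zeta \<alpha>" \<alpha>] zeta_le_eps[of \<alpha>] by (auto simp: e_special_def)

abbreviation zeta_init :: "(nat \<Rightarrow> 'a::infinite ordinal) \<Rightarrow> 'a ordinal" where
  "zeta_init \<alpha> \<equiv> nf_init (zeta \<alpha>)"

abbreviation zeta_last :: "(nat \<Rightarrow> 'a::infinite ordinal) \<Rightarrow> 'a ordinal" where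
  "zeta_last \<alpha> \<equiv> last (nf_exponents (zeta \<alpha>))"

definition limit_case :: "(nat \<Rightarrow> 'a::infinite ordinal) \<Rightarrow> bool" where
  "limit_case \<alpha> \<longleftrightarrow> 0 < zeta \<alpha> \<and> is_limit (zeta_last \<alpha>) \<and> finite {i. zeta \<alpha> \<le> \<alpha> i}"

lemma exponents_zeta:
  assumes "zeta \<alpha> \<noteq> 0"
  shows "exponents (zeta \<alpha>) = exponents (zeta_init \<alpha>) + {#zeta_last \<alpha>#}"
  using exponents_nf_init[OF assms] by simp

lemma zeta_init_less: "zeta \<alpha> \<noteq> 0 \<Longrightarrow> zeta_init \<alpha> < zeta \<alpha>"
  using nf_init_add_last[of "zeta \<alpha>"] ordinal_add_strict_mono_right[OF omega_pow_pos]
  by (metis add_0_right)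

lemma zeta_tsub_init: "zeta \<alpha> \<noteq> 0 \<Longrightarrow> zeta \<alpha> \<ominus> zeta_init \<alpha> = omega_pow (zeta_last \<alpha>)"
  using nf_init_add_last[of "zeta \<alpha>"] by (metis add_tsub_cancel)

lemma exponents_nat_sum_list_sorted:
  assumes "finite A"
  shows "exponents (nat_sum_list (map f (sorted_list_of_set A))) = (\<Sum>i\<in>A. exponents (f i))"
  using assms
  by (simp add: exponents_nat_sum_list comp_def sum_list_distinct_conv_sum_set)

lemma exponents_nat_sum_S_limit:
  assumes "limit_case \<alpha>"
  shows "exponents (nat_sum_S \<alpha>) =
    shifted_sum (zeta_init \<alpha>) \<alpha> {i. zeta \<alpha> \<le> \<alpha> i} + {#zeta_last \<alpha>#}"
proof -
  have pos: "zeta \<alpha> \<noteq> 0" and fin: "finite {i. zeta \<alpha> \<le> \<alpha> i}"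
    using assms by (auto simp: limit_case_def ordinal_pos_iff)
  have "(\<Sum>i\<in>{i. zeta \<alpha> \<le> \<alpha> i}. exponents (ord_diff (\<alpha> i) (zeta_init \<alpha>))) =
      (\<Sum>i\<in>{i. zeta \<alpha> \<le> \<alpha> i}. exponents (\<alpha> i \<ominus> zeta_init \<alpha>))"
  proof (rule sum.cong)
    fix i assume "i \<in> {i. zeta \<alpha> \<le> \<alpha> i}"
    then have "zeta_init \<alpha> \<le> \<alpha> i" using zeta_init_less[OF pos] by simp
    then show "exponents (ord_diff (\<alpha> i) (zeta_init \<alpha>)) = exponents (\<alpha> i \<ominus> zeta_init \<alpha>)"
      by (simp add: ord_diff_eq_tsub)
  qed simp
  then show ?thesis
    using assms fin
    by (simp add: nat_sum_S_def limit_case_def Let_def e_special_eq exponents_nat_sum_list_sorted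
        exponents_nat_prod_omega shifted_sum_def ac_simps)
qed

lemma exponents_nat_sum_S_nonlimit:
  assumes "\<not> limit_case \<alpha>" "finite I" "{i. zeta \<alpha> < \<alpha> i} \<subseteq> I"
  shows "exponents (nat_sum_S \<alpha>) = shifted_sum (zeta \<alpha>) \<alpha> I"
proof -
  have "(\<Sum>i\<in>e_special \<alpha>. exponents (ord_diff (\<alpha> i) (zeta \<alpha>))) =
      (\<Sum>i\<in>e_special \<alpha>. exponents (\<alpha> i \<ominus> zeta \<alpha>))"
    by (rule sum.cong) (simp_all add: ord_diff_eq_tsub zeta_le_e_special)
  then have "exponents (nat_sum_S \<alpha>) = shifted_sum (zeta \<alpha>) \<alpha> (e_special \<alpha>)"
    using assms(1) unfolding nat_sum_S_def Let_def
    by (subst if_not_P) (auto simp: limit_case_def exponents_nat_sum_list_sorted finite_e_special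
        exponents_nat_prod_omega shifted_sum_def)
  then show ?thesis
    using shifted_sum_support[OF finite_e_special zeta_less_e_special]
      shifted_sum_support[OF assms(2,3)] by simp
qed

text \<open>
  In the limit case the base is lowered from \<open>\<zeta>\<close> to \<open>zeta_init\<close>, and the additional summand is the
  further copy of the difference of the bases in \<open>shifted_sum_base_strict_mono\<close>.
\<close>

lemma exponents_nat_sum_S_le:
  assumes "finite I" "{i. zeta \<alpha> < \<alpha> i} \<subseteq> I"
  shows "exponents (nat_sum_S \<alpha>) \<le> shifted_sum (zeta \<alpha>) \<alpha> I"
proof (cases "limit_case \<alpha>")
  case True
  then have pos: "zeta \<alpha> \<noteq> 0" and fin: "finite {i. zeta \<alpha> \<le> \<alpha> i}"
    by (auto simp: limit_case_def ordinal_pos_iff)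
  let ?J = "{i. zeta \<alpha> \<le> \<alpha> i}"
  have "exponents (nat_sum_S \<alpha>) < shifted_sum (zeta \<alpha>) \<alpha> ?J"
    using shifted_sum_base_strict_mono[OF zeta_init_less[OF pos] fin]
    by (simp add: exponents_nat_sum_S_limit True zeta_tsub_init pos)
  also have "shifted_sum (zeta \<alpha>) \<alpha> ?J = shifted_sum (zeta \<alpha>) \<alpha> {i. zeta \<alpha> < \<alpha> i}"
    by (rule shifted_sum_support[OF fin]) auto
  also have "\<dots> = shifted_sum (zeta \<alpha>) \<alpha> I"
    by (rule shifted_sum_support[OF assms, symmetric])
  finally show ?thesis by simp
qed (simp add: exponents_nat_sum_S_nonlimit[OF _ assms])


section \<open>Monotonicity\<close>

lemma zeta_mono:
  assumes "\<And>i. \<beta> i \<le> \<alpha> i"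
  shows "zeta \<beta> \<le> zeta \<alpha>"
  by (rule zeta_le, rule finite_subset[OF _ finite_zeta[of \<alpha>]])
    (use assms in \<open>auto intro: less_le_trans\<close>)

text \<open>
  Here \<open>zeta \<beta>\<close> lies below \<open>zeta_init \<alpha> + omega_pow \<xi>\<close> with a limit \<open>\<xi>\<close>. Whatever \<open>\<beta>\<close> has beyond
  \<open>zeta_init \<alpha>\<close>, outside of the finitely many indices that contribute to the sum of \<open>\<alpha>\<close>, has exponents
  below \<open>\<xi>\<close>, and this remains so after they are increased by \<open>1\<close>.
\<close>

lemma nat_sum_S_less_limit_case:
  assumes le: "\<And>i. \<beta> i \<le> \<alpha> i" and less: "zeta \<beta> < zeta \<alpha>" and lim: "limit_case \<alpha>"
  shows "nat_sum_S \<beta> < nat_sum_S \<alpha>"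
proof -
  let ?h = "zeta_init \<alpha>" and ?\<xi> = "zeta_last \<alpha>"
  have pos: "zeta \<alpha> \<noteq> 0" and \<xi>: "is_limit ?\<xi>" and finJ: "finite {i. zeta \<alpha> \<le> \<alpha> i}"
    using lim by (auto simp: limit_case_def ordinal_pos_iff)
  have \<zeta>: "zeta \<alpha> = ?h + omega_pow ?\<xi>" using nf_init_add_last[OF pos] by simp
  define J where "J = {i. zeta \<alpha> \<le> \<alpha> i}"
  define I where "I = {i. zeta \<beta> < \<beta> i} - J"
  have fin: "finite I" "finite J" using finite_zeta[of \<beta>] finJ by (simp_all add: I_def J_def)
  have disj: "I \<inter> J = {}" by (auto simp: I_def)
  define d where "d = max (zeta \<beta>) ?h"
  define \<eta> where "\<eta> = d \<ominus> ?h"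
  have d: "?h \<le> d" "zeta \<beta> \<le> d" "d < zeta \<alpha>"
    using less zeta_init_less[OF pos] by (auto simp: d_def)
  have "\<eta> < omega_pow ?\<xi>"
    unfolding \<eta>_def by (rule tsub_less) (use d(3) \<zeta> in simp_all)
  then have \<eta>_small: "y < ?\<xi>" if "y \<in># exponents \<eta>" for y
    using that by (simp flip: exponents_less_single_iff)
  have "exponents (?h + \<eta>) = exponents ?h + exponents \<eta>"
    by (rule exponents_add_eq) (use \<eta>_small last_nf_exponents_le[OF pos] in \<open>meson less_imp_le order_trans\<close>)
  then have exp_d: "exponents d = exponents ?h + exponents \<eta>"
    by (simp add: \<eta>_def add_tsub d(1))
  have rest_small: "y < ?\<xi>" if "i \<in> I" "y \<in># exponents (\<beta> i \<ominus> d)" for i y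
  proof -
    have "\<beta> i < zeta \<alpha>" using that(1) le[of i] by (auto simp: I_def J_def)
    then have "\<beta> i \<ominus> ?h < omega_pow ?\<xi>" by (intro tsub_less) (use \<zeta> in simp_all)
    then have "\<beta> i \<ominus> d < omega_pow ?\<xi>" using tsub_antimono[OF d(1)] le_less_trans by blast
    then show ?thesis using that(2) by (simp flip: exponents_less_single_iff)
  qed
  have small: "incr (exponents \<eta>) + (\<Sum>i\<in>I. exponents (\<beta> i \<ominus> d)) < {#?\<xi>#}"
    using rest_small fin limit_add_one_less[OF \<xi>] \<eta>_small by (auto simp: set_mset_sum)
  have J: "(\<Sum>i\<in>J. exponents (\<beta> i \<ominus> d)) \<le> (\<Sum>i\<in>J. exponents (\<alpha> i \<ominus> ?h))"
  proof (rule sum_mono)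
    fix i
    have "\<beta> i \<ominus> d \<le> \<alpha> i \<ominus> ?h"
      using tsub_mono[OF le] tsub_antimono[OF d(1)] order_trans by blast
    then show "exponents (\<beta> i \<ominus> d) \<le> exponents (\<alpha> i \<ominus> ?h)" by (simp only: exponents_le_iff)
  qed
  have "exponents (nat_sum_S \<beta>) \<le> shifted_sum (zeta \<beta>) \<beta> (I \<union> J)"
    by (rule exponents_nat_sum_S_le) (use fin in \<open>auto simp: I_def\<close>)
  also have "\<dots> \<le> shifted_sum d \<beta> (I \<union> J)"
    by (rule shifted_sum_base_mono) (use fin d(2) in simp_all)
  also have "\<dots> = incr (exponents ?h) +
      ((incr (exponents \<eta>) + (\<Sum>i\<in>I. exponents (\<beta> i \<ominus> d))) + (\<Sum>i\<in>J. exponents (\<beta> i \<ominus> d)))"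
    by (simp add: shifted_sum_def exp_d sum.union_disjoint fin disj ac_simps)
  also have "\<dots> < incr (exponents ?h) + ({#?\<xi>#} + (\<Sum>i\<in>J. exponents (\<alpha> i \<ominus> ?h)))"
    by (rule add_strict_left_mono) (rule add_less_le_mono[OF small J])
  also have "\<dots> = exponents (nat_sum_S \<alpha>)"
    by (simp add: exponents_nat_sum_S_limit lim shifted_sum_def J_def ac_simps)
  finally show ?thesis by (simp only: exponents_less_iff)
qed

lemma nat_sum_S_strict_mono:
  assumes "\<beta> \<prec> \<alpha>"
  shows "nat_sum_S \<beta> < nat_sum_S \<alpha>"
proof -
  obtain j F b where F: "finite F" "\<And>i. i \<notin> F \<Longrightarrow> \<beta> i \<le> b" and j: "\<beta> j \<le> b" "b < \<alpha> j"
    and le: "\<And>i. \<beta> i \<le> \<alpha> i"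
    using assms unfolding seq_less_def by blast
  have "finite {i. b < \<beta> i}"
    by (rule finite_subset[OF _ F(1)]) (use F(2) in \<open>auto simp: not_le[symmetric]\<close>)
  then have zb: "zeta \<beta> \<le> b" by (rule zeta_le)
  have \<beta>j: "\<beta> j < \<alpha> j" using j by simp
  note z_le = zeta_mono[of \<beta> \<alpha>, OF le]
  show ?thesis
  proof (cases "limit_case \<alpha>")
    case False
    define I where "I = {i. zeta \<alpha> < \<alpha> i} \<union> {i. zeta \<beta> < \<beta> i}"
    have fin: "finite I" by (simp add: I_def finite_zeta)
    have "exponents (nat_sum_S \<beta>) \<le> shifted_sum (zeta \<beta>) \<beta> I"
      by (rule exponents_nat_sum_S_le) (use fin in \<open>auto simp: I_def\<close>)
    also have "\<dots> < shifted_sum (zeta \<alpha>) \<alpha> I"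
    proof (cases "zeta \<beta> = zeta \<alpha>")
      case True
      then have "zeta \<alpha> < \<alpha> j" using zb j(2) by simp
      then show ?thesis
        using True shifted_sum_strict_mono[of I \<beta> \<alpha> j "zeta \<alpha>"] fin le \<beta>j by (simp add: I_def)
    next
      case False
      then have "zeta \<beta> < zeta \<alpha>" using z_le by simp
      then have "shifted_sum (zeta \<beta>) \<beta> I + exponents (zeta \<alpha> \<ominus> zeta \<beta>) < shifted_sum (zeta \<alpha>) \<beta> I"
        using fin by (rule shifted_sum_base_strict_mono)
      then have "shifted_sum (zeta \<beta>) \<beta> I < shifted_sum (zeta \<alpha>) \<beta> I"
        using le_less_trans[OF less_eq_multiset_plus_right] by blast
      also have "\<dots> \<le> shifted_sum (zeta \<alpha>) \<alpha> I" by (rule shifted_sum_mono[OF le])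
      finally show ?thesis .
    qed
    also have "\<dots> = exponents (nat_sum_S \<alpha>)"
      by (rule exponents_nat_sum_S_nonlimit[symmetric]) (use False fin in \<open>auto simp: I_def\<close>)
    finally show ?thesis by (simp only: exponents_less_iff)
  next
    case lim: True
    show ?thesis
    proof (cases "zeta \<beta> = zeta \<alpha>")
      case False
      then show ?thesis using nat_sum_S_less_limit_case[OF le _ lim] z_le by simp
    next
      case z_eq: True
      let ?h = "zeta_init \<alpha>"
      have pos: "zeta \<alpha> \<noteq> 0" and finJ: "finite {i. zeta \<alpha> \<le> \<alpha> i}"
        using lim by (auto simp: limit_case_def ordinal_pos_iff)
      have sub: "{i. zeta \<beta> \<le> \<beta> i} \<subseteq> {i. zeta \<alpha> \<le> \<alpha> i}"
        using z_eq le order_trans by auto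
      then have "limit_case \<beta>"
        using lim finite_subset[OF sub finJ] by (auto simp: limit_case_def z_eq)
      then have "exponents (nat_sum_S \<beta>) = shifted_sum ?h \<beta> {i. zeta \<beta> \<le> \<beta> i} + {#zeta_last \<alpha>#}"
        by (simp add: exponents_nat_sum_S_limit z_eq)
      also have "\<dots> \<le> shifted_sum ?h \<beta> {i. zeta \<alpha> \<le> \<alpha> i} + {#zeta_last \<alpha>#}"
        unfolding shifted_sum_def
        by (intro add_right_mono add_left_mono sum_mono2 finJ sub) simp
      also have "\<dots> < shifted_sum ?h \<alpha> {i. zeta \<alpha> \<le> \<alpha> i} + {#zeta_last \<alpha>#}"
      proof (rule add_strict_right_mono, rule shifted_sum_strict_mono[where j = j])
        have "zeta \<alpha> < \<alpha> j" using zb z_eq j(2) by simp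
        then show "j \<in> {i. zeta \<alpha> \<le> \<alpha> i}" "?h < \<alpha> j"
          using zeta_init_less[OF pos] by auto
      qed (simp_all add: finJ le \<beta>j)
      also have "\<dots> = exponents (nat_sum_S \<alpha>)"
        by (simp add: exponents_nat_sum_S_limit lim)
      finally show ?thesis by (simp only: exponents_less_iff)
    qed
  qed
qed

section \<open>Cofinality\<close>

text \<open>
  A smaller multiset arises by replacing some elements by smaller ones. Only the largest replaced
  element \<open>m\<close> matters: restoring the others gives an upper bound. Applied to the exponents of a natural
  sum, this isolates the summand to be decreased.
\<close>

lemma multiset_less_exchangeE:
  fixes N :: "'b::linorder multiset"
  assumes "D < N"
  obtains m R where "m \<in># N" "\<And>r. r \<in># R \<Longrightarrow> r < m" "D \<le> N - {#m#} + R"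
proof -
  obtain X Y where X: "X \<noteq> {#}" "X \<subseteq># N" and D: "D = N - X + Y"
    and Y: "\<And>k. k \<in># Y \<Longrightarrow> \<exists>a. a \<in># X \<and> k < a"
    using assms unfolding less_multiset\<^sub>D\<^sub>M by blast
  define m where "m = Max_mset X"
  have m: "m \<in># X" "\<And>a. a \<in># X \<Longrightarrow> a \<le> m" using X(1) by (simp_all add: m_def)
  obtain X' where "X = {#m#} + X'" using m(1) by (metis mset_add add_mset_add_single add.commute)
  then have "N - X = N - {#m#} - X'" by (simp only: diff_diff_add)
  then have "N - X \<le> N - {#m#}" by (simp only: subset_eq_imp_le_multiset diff_subset_eq_self)
  then have "D \<le> N - {#m#} + Y" unfolding D by (rule add_right_mono)
  moreover have "r < m" if "r \<in># Y" for r using Y[OF that] m(2) less_le_trans by blast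
  moreover have "m \<in># N" using m(1) X(2) by (rule mset_subset_eqD[rotated])
  ultimately show thesis by (intro that)
qed

lemma exchange_less:
  fixes M :: "'b::linorder multiset"
  assumes "m \<in># M" "\<And>r. r \<in># R \<Longrightarrow> r < m"
  shows "M - {#m#} + R < M"
proof -
  have "R < {#m#}" using assms(2) by simp
  then show ?thesis using assms(1) by (intro union_le_diff_plus) simp_all
qed

lemma le_replicate_mset:
  fixes R :: "'b::linorder multiset"
  shows "(\<And>r. r \<in># R \<Longrightarrow> r \<le> a) \<Longrightarrow> R \<le> replicate_mset (size R) a"
  by (induction R) (simp_all add: add_mset_le_le_le)

lemma sum_single_mset: "finite A \<Longrightarrow> (\<Sum>i\<in>A. {#a#}) = replicate_mset (card A) a"
  by (induction A rule: finite_induct) simp_all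

text \<open>
  Cutting \<open>\<alpha>\<close> down to \<open>b\<close> outside of \<open>K\<close> leaves infinitely many entries equal to \<open>b\<close>, so the limit
  case does not apply to the result, and \<open>b\<close> itself becomes the base of the sum.
\<close>

lemma ex_truncation:
  assumes "b < zeta \<alpha>" "finite K"
  shows "\<exists>\<beta>. \<beta> \<prec> \<alpha> \<and> exponents (nat_sum_S \<beta>) = shifted_sum b \<alpha> K"
proof -
  define \<beta> where "\<beta> = (\<lambda>i. if i \<in> K then \<alpha> i else min (\<alpha> i) b)"
  have inf: "infinite ({i. b < \<alpha> i} - K)"
    using infinite_less_zeta[OF assms(1)] assms(2) by simp
  then obtain j where j: "j \<notin> K" "b < \<alpha> j"
    by (metis DiffE equals0I finite.emptyI mem_Collect_eq)
  have \<beta>b: "\<beta> i = b" if "i \<in> {i. b < \<alpha> i} - K" for i using that by (simp add: \<beta>_def)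
  have "\<beta> \<prec> \<alpha>"
    unfolding seq_less_def
    by (rule exI[of _ j], rule exI[of _ K], rule exI[of _ b])
      (use j assms(2) in \<open>simp add: \<beta>_def\<close>)
  have sub: "{i. b < \<beta> i} \<subseteq> K" by (auto simp: \<beta>_def split: if_splits)
  have z: "zeta \<beta> = b"
  proof (rule zeta_eqI)
    show "finite {i. b < \<beta> i}" using finite_subset[OF sub assms(2)] .
    show "infinite {i. y < \<beta> i}" if "y < b" for y
      by (rule infinite_super[OF _ inf]) (use \<beta>b that in auto)
  qed
  have "infinite {i. b \<le> \<beta> i}"
    by (rule infinite_super[OF _ inf]) (use \<beta>b in auto)
  then have "\<not> limit_case \<beta>" by (simp add: limit_case_def z)
  then have "exponents (nat_sum_S \<beta>) = shifted_sum b \<beta> K"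
    using exponents_nat_sum_S_nonlimit[of \<beta> K] assms(2) sub by (simp add: z)
  also have "\<dots> = shifted_sum b \<alpha> K" by (simp add: shifted_sum_def \<beta>_def)
  finally show ?thesis using \<open>\<beta> \<prec> \<alpha>\<close> by blast
qed

lemma decrease_entry:
  assumes "zeta \<alpha> \<le> \<gamma>" "\<gamma> < \<alpha> j"
  shows "\<alpha>(j := \<gamma>) \<prec> \<alpha>"
    and "zeta (\<alpha>(j := \<gamma>)) = zeta \<alpha>"
    and "{i. zeta \<alpha> \<le> (\<alpha>(j := \<gamma>)) i} = {i. zeta \<alpha> \<le> \<alpha> i}"
    and "limit_case (\<alpha>(j := \<gamma>)) \<longleftrightarrow> limit_case \<alpha>"
proof -
  show "\<alpha>(j := \<gamma>) \<prec> \<alpha>"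
    unfolding seq_less_def
    by (rule exI[of _ j], rule exI[of _ "{i. zeta \<alpha> < \<alpha> i}"], rule exI[of _ \<gamma>])
      (use assms finite_zeta[of \<alpha>] in \<open>auto simp: not_less\<close>)
  show z: "zeta (\<alpha>(j := \<gamma>)) = zeta \<alpha>"
  proof (rule zeta_eqI)
    show "finite {i. zeta \<alpha> < (\<alpha>(j := \<gamma>)) i}"
      by (rule finite_subset[OF _ finite_zeta[of \<alpha>]]) (use assms in \<open>auto split: if_splits\<close>)
    fix y assume y: "y < zeta \<alpha>"
    have "{i. y < \<alpha> i} \<subseteq> {i. y < (\<alpha>(j := \<gamma>)) i}" using assms(1) y by auto
    then show "infinite {i. y < (\<alpha>(j := \<gamma>)) i}" using infinite_super infinite_less_zeta[OF y] by blast
  qed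
  show set: "{i. zeta \<alpha> \<le> (\<alpha>(j := \<gamma>)) i} = {i. zeta \<alpha> \<le> \<alpha> i}" using assms by auto
  show "limit_case (\<alpha>(j := \<gamma>)) \<longleftrightarrow> limit_case \<alpha>" unfolding limit_case_def z set ..
qed

text \<open>An exchange of exponents inside a single difference is realized by a change of that entry.\<close>

lemma shifted_sum_exchange_entry:
  assumes "finite I" "j \<in> I" "m \<in># exponents (\<alpha> j \<ominus> c)"
  shows "shifted_sum c \<alpha> I - {#m#} + R =
    shifted_sum c (\<alpha>(j := c + of_exponents (exponents (\<alpha> j \<ominus> c) - {#m#} + R))) I"
proof -
  let ?A = "incr (exponents c) + (\<Sum>i\<in>I - {j}. exponents (\<alpha> i \<ominus> c))"
  have split: "shifted_sum c (\<alpha>(j := \<gamma>)) I = ?A + exponents (\<gamma> \<ominus> c)" for \<gamma>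
    unfolding shifted_sum_def sum.remove[OF assms(1,2)] by (simp add: ac_simps)
  obtain E where E: "exponents (\<alpha> j \<ominus> c) = add_mset m E"
    using assms(3) by (metis mset_add)
  have "shifted_sum c \<alpha> I = ?A + add_mset m E"
    using split[of "\<alpha> j"] by (simp add: E)
  then show ?thesis unfolding split E by simp
qed

text \<open>
  Exchanging an element \<open>x + 1\<close> that stems from \<open>\<zeta> \<otimes> \<omega>\<close>. If \<open>x\<close> is not the last exponent of \<open>\<zeta>\<close>, the
  result is already bounded by the sum with base \<open>zeta_init\<close>; otherwise it costs finitely
  many copies of the last exponent.
\<close>

lemma exchange_base_le:
  assumes "zeta \<alpha> \<noteq> 0" "x \<in># exponents (zeta \<alpha>)" "\<And>r. r \<in># R \<Longrightarrow> r < x + 1"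
  shows "\<exists>k. incr (exponents (zeta \<alpha>)) - {#x + 1#} + R \<le>
    incr (exponents (zeta_init \<alpha>)) + replicate_mset k (zeta_last \<alpha>)"
proof (cases "x = zeta_last \<alpha>")
  case True
  have "incr (exponents (zeta \<alpha>)) - {#x + 1#} + R = incr (exponents (zeta_init \<alpha>)) + R"
    by (simp add: exponents_zeta[OF assms(1)] True)
  also have "\<dots> \<le> incr (exponents (zeta_init \<alpha>)) + replicate_mset (size R) (zeta_last \<alpha>)"
    by (intro add_left_mono le_replicate_mset) (use assms(3) True in simp)
  finally show ?thesis by blast
next
  case False
  then have x: "x \<in># exponents (zeta_init \<alpha>)"
    using assms(2) by (simp add: exponents_zeta[OF assms(1)])
  then have less: "zeta_last \<alpha> < x"
    using last_nf_exponents_le[OF assms(1)] False le_less by blast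
  define M where "M = exponents (zeta_init \<alpha>) - {#x#}"
  have M: "exponents (zeta_init \<alpha>) = add_mset x M" using x by (simp add: M_def)
  have "{#zeta_last \<alpha> + 1#} + R < {#x + 1#}" using assms(3) less by simp
  then have "incr M + ({#zeta_last \<alpha> + 1#} + R) < incr M + {#x + 1#}"
    by (rule add_strict_left_mono)
  then have "incr (exponents (zeta \<alpha>)) - {#x + 1#} + R \<le> incr (exponents (zeta_init \<alpha>))"
    by (simp add: exponents_zeta[OF assms(1)] M ac_simps)
  then show ?thesis by (intro exI[of _ 0]) simp
qed

text \<open>
  Finitely many copies of the last exponent \<open>\<xi>\<close> of \<open>\<zeta>\<close> on top of \<open>zeta_init\<close> can be afforded by a
  smaller sequence: if infinitely many entries equal \<open>\<zeta>\<close>, by keeping \<open>k\<close> of them; otherwise \<open>\<zeta>\<close> is a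
  limit, \<open>\<xi> = \<eta> + 1\<close>, and the base may be raised to \<open>zeta_init\<close> plus \<open>k\<close> copies of
  \<open>omega_pow \<eta>\<close>.
\<close>

lemma ex_below_nonlimit_case:
  assumes nonlim: "\<not> limit_case \<alpha>" and pos: "zeta \<alpha> \<noteq> 0" and I: "I = {i. zeta \<alpha> < \<alpha> i}"
  shows "\<exists>\<beta>. \<beta> \<prec> \<alpha> \<and> incr (exponents (zeta_init \<alpha>)) + replicate_mset k (zeta_last \<alpha>) +
    (\<Sum>i\<in>I. exponents (\<alpha> i \<ominus> zeta \<alpha>)) \<le> exponents (nat_sum_S \<beta>)"
proof -
  let ?h = "zeta_init \<alpha>" and ?\<xi> = "zeta_last \<alpha>" and ?\<zeta> = "zeta \<alpha>"
  have finI: "finite I" by (simp add: I finite_zeta)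
  have h: "?h < ?\<zeta>" by (rule zeta_init_less[OF pos])
  have diffs: "(\<Sum>i\<in>I. exponents (\<alpha> i \<ominus> ?\<zeta>)) \<le> (\<Sum>i\<in>I. exponents (\<alpha> i \<ominus> b))" if "b \<le> ?\<zeta>" for b
    by (rule sum_mono) (simp add: exponents_le_iff tsub_antimono that)
  show ?thesis
  proof (cases "finite {i. \<alpha> i = ?\<zeta>}")
    case False
    then obtain K where K: "K \<subseteq> {i. \<alpha> i = ?\<zeta>}" "finite K" "card K = k"
      using infinite_arbitrarily_large by blast
    have disj: "I \<inter> K = {}" using K(1) by (auto simp: I)
    obtain \<beta> where \<beta>: "\<beta> \<prec> \<alpha>" "exponents (nat_sum_S \<beta>) = shifted_sum ?h \<alpha> (I \<union> K)"
      using ex_truncation[OF h, of "I \<union> K"] finI K(2) by auto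
    have "(\<Sum>i\<in>K. exponents (\<alpha> i \<ominus> ?h)) = (\<Sum>i\<in>K. {#?\<xi>#})"
      by (rule sum.cong) (use K(1) in \<open>auto simp: zeta_tsub_init[OF pos]\<close>)
    then have "exponents (nat_sum_S \<beta>) = incr (exponents ?h) + replicate_mset k ?\<xi> +
        (\<Sum>i\<in>I. exponents (\<alpha> i \<ominus> ?h))"
      by (simp add: \<beta>(2) shifted_sum_def sum.union_disjoint finI K(2,3) disj sum_single_mset ac_simps)
    then show ?thesis using \<beta>(1) diffs[of ?h] h add_left_mono by (metis less_imp_le)
  next
    case True
    have "{i. ?\<zeta> \<le> \<alpha> i} = I \<union> {i. \<alpha> i = ?\<zeta>}" by (auto simp: I)
    then have fin: "finite {i. ?\<zeta> \<le> \<alpha> i}" using True finI by simp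
    then have "\<not> is_limit ?\<xi>" using nonlim pos by (simp add: limit_case_def ordinal_pos_iff)
    moreover have "?\<xi> \<noteq> 0"
    proof
      assume "?\<xi> = 0"
      then have "?\<zeta> = ?h + 1" using nf_init_add_last[OF pos] by simp
      then have "?h < x \<longleftrightarrow> ?\<zeta> \<le> x" for x by (metis ordinal_add_one_le_iff)
      then show False using infinite_less_zeta[OF h] fin by simp
    qed
    ultimately obtain \<eta> where \<eta>: "?\<xi> = \<eta> + 1" by (auto simp: is_limit_def)
    define \<rho> where "\<rho> = of_exponents (replicate_mset k \<eta>)"
    have "exponents (?h + \<rho>) = exponents ?h + exponents \<rho>"
    proof (rule exponents_add_eq)
      fix x y assume "x \<in># exponents ?h" "y \<in># exponents \<rho>"
      then have "\<eta> < x" "y = \<eta>"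
        using last_nf_exponents_le[OF pos, of x] by (simp_all add: \<rho>_def \<eta> split: if_splits)
      then show "y \<le> x" by simp
    qed
    then have exp_b: "exponents (?h + \<rho>) = exponents ?h + replicate_mset k \<eta>"
      by (simp add: \<rho>_def)
    have "\<rho> < omega_pow ?\<xi>"
      unfolding \<rho>_def by (rule of_exponents_less) (simp add: \<eta> split: if_splits)
    then have b: "?h + \<rho> < ?\<zeta>"
      using nf_init_add_last[OF pos] by (metis ordinal_add_less_cancel)
    obtain \<beta> where \<beta>: "\<beta> \<prec> \<alpha>" "exponents (nat_sum_S \<beta>) = shifted_sum (?h + \<rho>) \<alpha> I"
      using ex_truncation[OF b finI] by blast
    have "exponents (nat_sum_S \<beta>) = incr (exponents ?h) + replicate_mset k ?\<xi> +
        (\<Sum>i\<in>I. exponents (\<alpha> i \<ominus> (?h + \<rho>)))"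
      by (simp add: \<beta>(2) shifted_sum_def exp_b \<eta>)
    then show ?thesis using \<beta>(1) diffs[of "?h + \<rho>"] b add_left_mono by (metis less_imp_le)
  qed
qed

lemma nat_sum_S_cofinal_nonlimit:
  assumes nonlim: "\<not> limit_case \<alpha>" and D: "D < exponents (nat_sum_S \<alpha>)"
  shows "\<exists>\<beta>. \<beta> \<prec> \<alpha> \<and> D \<le> exponents (nat_sum_S \<beta>)"
proof -
  let ?\<zeta> = "zeta \<alpha>"
  define I where "I = {i. ?\<zeta> < \<alpha> i}"
  have finI: "finite I" by (simp add: I_def finite_zeta)
  have N: "exponents (nat_sum_S \<alpha>) = shifted_sum ?\<zeta> \<alpha> I"
    by (rule exponents_nat_sum_S_nonlimit[OF nonlim finI]) (simp add: I_def)
  obtain m R where m: "m \<in># shifted_sum ?\<zeta> \<alpha> I" and R: "\<And>r. r \<in># R \<Longrightarrow> r < m"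
    and DR: "D \<le> shifted_sum ?\<zeta> \<alpha> I - {#m#} + R"
    using multiset_less_exchangeE[OF D[unfolded N]] by blast
  from m consider j where "j \<in> I" "m \<in># exponents (\<alpha> j \<ominus> ?\<zeta>)"
    | x where "x \<in># exponents ?\<zeta>" "m = x + 1"
    using finI by (auto simp: shifted_sum_def set_mset_sum)
  then show ?thesis
  proof cases
    case (1 j)
    define E where "E = exponents (\<alpha> j \<ominus> ?\<zeta>) - {#m#} + R"
    have "E < exponents (\<alpha> j \<ominus> ?\<zeta>)"
      unfolding E_def using 1(2) R by (rule exchange_less)
    then have "of_exponents E < \<alpha> j \<ominus> ?\<zeta>"
      by (simp flip: exponents_less_iff)
    then have less: "?\<zeta> + of_exponents E < \<alpha> j" by (simp add: less_tsub_iff)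
    note dec = decrease_entry[OF ordinal_add_ge_left less]
    have "{i. ?\<zeta> < (\<alpha>(j := ?\<zeta> + of_exponents E)) i} \<subseteq> I"
      using less by (auto simp: I_def split: if_splits)
    then have "exponents (nat_sum_S (\<alpha>(j := ?\<zeta> + of_exponents E))) =
        shifted_sum ?\<zeta> (\<alpha>(j := ?\<zeta> + of_exponents E)) I"
      using exponents_nat_sum_S_nonlimit[of "\<alpha>(j := ?\<zeta> + of_exponents E)" I] nonlim finI
      unfolding dec(2,4) by blast
    then have "D \<le> exponents (nat_sum_S (\<alpha>(j := ?\<zeta> + of_exponents E)))"
      using DR shifted_sum_exchange_entry[of I j m \<alpha> ?\<zeta> R] finI 1 by (simp add: E_def)
    then show ?thesis using dec(1) by blast
  next
    case (2 x)
    then have pos: "?\<zeta> \<noteq> 0" by auto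
    let ?S = "\<Sum>i\<in>I. exponents (\<alpha> i \<ominus> ?\<zeta>)"
    obtain k where k: "incr (exponents ?\<zeta>) - {#x + 1#} + R \<le>
        incr (exponents (zeta_init \<alpha>)) + replicate_mset k (zeta_last \<alpha>)"
      using exchange_base_le[OF pos 2(1)] R 2(2) by blast
    have "x + 1 \<in># incr (exponents ?\<zeta>)" using 2(1) by auto
    then have "shifted_sum ?\<zeta> \<alpha> I - {#m#} + R = (incr (exponents ?\<zeta>) - {#x + 1#} + R) + ?S"
      by (simp add: shifted_sum_def 2(2) ac_simps)
    also have "\<dots> \<le> incr (exponents (zeta_init \<alpha>)) + replicate_mset k (zeta_last \<alpha>) + ?S"
      using k by (rule add_right_mono)
    finally have "D \<le> incr (exponents (zeta_init \<alpha>)) + replicate_mset k (zeta_last \<alpha>) + ?S"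
      using DR by (rule order_trans[rotated])
    then show ?thesis
      using ex_below_nonlimit_case[OF nonlim pos I_def, of k] order_trans by blast
  qed
qed

text \<open>
  Finitely many exponents below a limit exponent \<open>\<xi>\<close> are outweighed by some \<open>\<rho> + 1 < \<xi>\<close>, and raising the base from
  \<open>zeta_init\<close> to \<open>zeta_init + omega_pow \<rho>\<close> does not affect differences that are at least
  \<open>omega_pow \<xi>\<close>, by absorption.
\<close>

lemma ex_below_limit_case:
  assumes lim: "limit_case \<alpha>" and J: "J = {i. zeta \<alpha> \<le> \<alpha> i}" and R: "\<And>r. r \<in># R \<Longrightarrow> r < zeta_last \<alpha>"
  shows "\<exists>\<beta>. \<beta> \<prec> \<alpha> \<and> shifted_sum (zeta_init \<alpha>) \<alpha> J + R \<le> exponents (nat_sum_S \<beta>)"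
proof -
  let ?h = "zeta_init \<alpha>" and ?\<xi> = "zeta_last \<alpha>"
  have pos: "zeta \<alpha> \<noteq> 0" and \<xi>: "is_limit ?\<xi>" and finJ: "finite J"
    using lim by (auto simp: limit_case_def ordinal_pos_iff J)
  have "\<exists>\<rho><?\<xi>. R \<le> {#\<rho> + 1#}"
  proof (cases "R = {#}")
    case True
    then show ?thesis using \<xi> by (auto simp: is_limit_def ordinal_pos_iff intro!: exI[of _ 0])
  next
    case False
    then have "R \<le> {#Max_mset R + 1#}" by simp
    then show ?thesis using R False by (meson Max_in finite_set_mset set_mset_eq_empty_iff)
  qed
  then obtain \<rho> where \<rho>: "\<rho> < ?\<xi>" "R \<le> {#\<rho> + 1#}" by blast
  define b where "b = ?h + omega_pow \<rho>"
  have "exponents (?h + omega_pow \<rho>) = exponents ?h + exponents (omega_pow \<rho>)"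
    by (rule exponents_add_eq)
      (use less_le_trans[OF \<rho>(1) last_nf_exponents_le[OF pos]] in \<open>simp add: less_imp_le\<close>)
  then have exp_b: "exponents b = exponents ?h + {#\<rho>#}" by (simp add: b_def)
  have "b < zeta \<alpha>"
    using nf_init_add_last[OF pos] \<rho>(1) unfolding b_def
    by (metis ordinal_add_less_cancel omega_pow_less_iff)
  then obtain \<beta> where \<beta>: "\<beta> \<prec> \<alpha>" "exponents (nat_sum_S \<beta>) = shifted_sum b \<alpha> J"
    using ex_truncation finJ by blast
  have "\<alpha> i \<ominus> ?h \<le> \<alpha> i \<ominus> b" if "i \<in> J" for i
  proof -
    have "omega_pow ?\<xi> \<le> \<alpha> i \<ominus> ?h"
      using tsub_mono[of "zeta \<alpha>" "\<alpha> i" ?h] that by (simp add: J zeta_tsub_init[OF pos])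
    also have le: "\<alpha> i \<ominus> ?h \<le> omega_pow \<rho> + (\<alpha> i \<ominus> b)"
      using le_add_tsub[of "\<alpha> i" b] by (simp add: tsub_le_iff b_def add.assoc)
    finally have "omega_pow ?\<xi> \<le> \<alpha> i \<ominus> b"
      using add_less_omega_pow[of "omega_pow \<rho>" ?\<xi> "\<alpha> i \<ominus> b"] \<rho>(1) by (meson not_less omega_pow_less_iff)
    then show ?thesis
      using le add_omega_pow_absorb[of "omega_pow \<rho>" ?\<xi>] \<rho>(1) by simp
  qed
  then have "(\<Sum>i\<in>J. exponents (\<alpha> i \<ominus> ?h)) \<le> (\<Sum>i\<in>J. exponents (\<alpha> i \<ominus> b))"
    by (intro sum_mono) (simp add: exponents_le_iff)
  then have "incr (exponents ?h) + ((\<Sum>i\<in>J. exponents (\<alpha> i \<ominus> ?h)) + R) \<le>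
      incr (exponents ?h) + ((\<Sum>i\<in>J. exponents (\<alpha> i \<ominus> b)) + {#\<rho> + 1#})"
    using \<rho>(2) by (intro add_left_mono add_mono)
  then have "shifted_sum ?h \<alpha> J + R \<le> exponents (nat_sum_S \<beta>)"
    by (simp add: \<beta>(2) shifted_sum_def exp_b ac_simps)
  then show ?thesis using \<beta>(1) by blast
qed

text \<open>
  If the exchanged element is \<open>\<xi>\<close> itself, or comes from \<open>zeta_init \<otimes> \<omega>\<close> and so outweighs the summand
  \<open>omega_pow \<xi>\<close>, that summand may be given up and a truncation suffices. Any other element belongs to
  an entry above \<open>\<zeta>\<close>, which can be decreased.
\<close>

lemma nat_sum_S_cofinal_limit:
  assumes lim: "limit_case \<alpha>" and D: "D < exponents (nat_sum_S \<alpha>)"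
  shows "\<exists>\<beta>. \<beta> \<prec> \<alpha> \<and> D \<le> exponents (nat_sum_S \<beta>)"
proof -
  let ?h = "zeta_init \<alpha>" and ?\<xi> = "zeta_last \<alpha>" and ?\<zeta> = "zeta \<alpha>"
  have pos: "?\<zeta> \<noteq> 0" and finJ: "finite {i. ?\<zeta> \<le> \<alpha> i}"
    using lim by (auto simp: limit_case_def ordinal_pos_iff)
  define J where "J = {i. ?\<zeta> \<le> \<alpha> i}"
  have N: "exponents (nat_sum_S \<alpha>) = shifted_sum ?h \<alpha> J + {#?\<xi>#}"
    by (simp add: exponents_nat_sum_S_limit lim J_def)
  obtain m R where m: "m \<in># shifted_sum ?h \<alpha> J + {#?\<xi>#}" and R: "\<And>r. r \<in># R \<Longrightarrow> r < m"
    and DR: "D \<le> shifted_sum ?h \<alpha> J + {#?\<xi>#} - {#m#} + R"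
    using multiset_less_exchangeE[OF D[unfolded N]] by blast
  have reduced: ?thesis if "\<And>r. r \<in># R' \<Longrightarrow> r < ?\<xi>" "D \<le> shifted_sum ?h \<alpha> J + R'" for R'
    using ex_below_limit_case[OF lim J_def that(1)] that(2) order_trans by blast
  consider "m = ?\<xi>" | x where "x \<in># exponents ?h" "m = x + 1"
    | j where "m \<noteq> ?\<xi>" "j \<in> J" "m \<in># exponents (\<alpha> j \<ominus> ?h)"
    using m finJ by (auto simp: shifted_sum_def set_mset_sum J_def)
  then show ?thesis
  proof cases
    case 1
    then show ?thesis using reduced[of R] R DR by simp
  next
    case (2 x)
    then have mem: "m \<in># shifted_sum ?h \<alpha> J" by (auto simp: shifted_sum_def)
    have "?\<xi> \<le> x" using last_nf_exponents_le[OF pos] 2(1) by blast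
    then have "shifted_sum ?h \<alpha> J - {#m#} + ({#?\<xi>#} + R) < shifted_sum ?h \<alpha> J"
      using R 2(2) by (intro exchange_less[OF mem]) auto
    then show ?thesis using reduced[of "{#}"] DR mem by simp
  next
    case (3 j)
    have "\<alpha> j \<noteq> ?\<zeta>" using 3(1,3) zeta_tsub_init[OF pos] by auto
    then have "?\<zeta> < \<alpha> j" using 3(2) by (simp add: J_def)
    then have less\<xi>: "omega_pow ?\<xi> < \<alpha> j \<ominus> ?h"
      using nf_init_add_last[OF pos] by (simp add: less_tsub_iff)
    define E where "E = exponents (\<alpha> j \<ominus> ?h) - {#m#} + R"
    have "E < exponents (\<alpha> j \<ominus> ?h)"
      unfolding E_def using 3(3) R by (rule exchange_less)
    then have lessE: "of_exponents E < \<alpha> j \<ominus> ?h"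
      by (simp flip: exponents_less_iff)
    \<comment> \<open>The entry must not drop below \<open>\<zeta>\<close>, as the limit case would then lose this index.\<close>
    define \<gamma> where "\<gamma> = ?h + max (of_exponents E) (omega_pow ?\<xi>)"
    have "?h + omega_pow ?\<xi> \<le> \<gamma>" "\<gamma> < \<alpha> j"
      using less\<xi> lessE by (auto simp: \<gamma>_def less_tsub_iff max_def)
    then have \<gamma>: "?\<zeta> \<le> \<gamma>" "\<gamma> < \<alpha> j" using nf_init_add_last[OF pos] by simp_all
    note dec = decrease_entry[OF \<gamma>]
    have "D \<le> shifted_sum ?h (\<alpha>(j := ?h + of_exponents E)) J + {#?\<xi>#}"
      using DR shifted_sum_exchange_entry[of J j m \<alpha> ?h R] finJ 3
      by (simp add: E_def flip: J_def)
    also have "\<dots> \<le> shifted_sum ?h (\<alpha>(j := \<gamma>)) J + {#?\<xi>#}"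
      by (intro add_right_mono shifted_sum_mono) (simp add: \<gamma>_def)
    also have "\<dots> = exponents (nat_sum_S (\<alpha>(j := \<gamma>)))"
      using exponents_nat_sum_S_limit[of "\<alpha>(j := \<gamma>)"] lim unfolding dec(2-4) J_def by simp
    finally show ?thesis using dec(1) by blast
  qed
qed

lemma nat_sum_S_cofinal:
  assumes "\<delta> < nat_sum_S \<alpha>"
  shows "\<exists>\<beta>. \<beta> \<prec> \<alpha> \<and> \<delta> \<le> nat_sum_S \<beta>"
  using nat_sum_S_cofinal_limit[of \<alpha> "exponents \<delta>"] nat_sum_S_cofinal_nonlimit[of \<alpha> "exponents \<delta>"]
    assms by (auto simp: exponents_less_iff exponents_le_iff)


section \<open>The rank of a sequence\<close>

theorem theorem5p4:
  fixes \<alpha> :: "nat \<Rightarrow> 'a::infinite ordinal"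
  shows "seq_rank \<alpha> = nat_sum_S \<alpha>"
proof (induction \<alpha> rule: seq_rank.induct)
  case (1 \<alpha>)
  show ?case
    unfolding seq_rank.simps[of \<alpha>]
  proof (rule Least_equality)
    show "\<forall>\<beta>. \<beta> \<prec> \<alpha> \<longrightarrow> seq_rank \<beta> < nat_sum_S \<alpha>"
    proof (intro allI impI)
      fix \<beta> assume "\<beta> \<prec> \<alpha>"
      then show "seq_rank \<beta> < nat_sum_S \<alpha>"
        unfolding 1[OF \<open>\<beta> \<prec> \<alpha>\<close>] by (rule nat_sum_S_strict_mono)
    qed
    fix \<gamma> assume \<gamma>: "\<forall>\<beta>. \<beta> \<prec> \<alpha> \<longrightarrow> seq_rank \<beta> < \<gamma>"
    show "nat_sum_S \<alpha> \<le> \<gamma>"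
    proof (rule ccontr)
      assume "\<not> nat_sum_S \<alpha> \<le> \<gamma>"
      then have "\<gamma> < nat_sum_S \<alpha>" by simp
      then obtain \<beta> where "\<beta> \<prec> \<alpha>" "\<gamma> \<le> nat_sum_S \<beta>"
        using nat_sum_S_cofinal by blast
      then show False using 1[of \<beta>] \<gamma> leD by metis
    qed
  qed
qed

end
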